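(* Let $k$ be a field of characteristic zero, let $L$ be a free preLie algebra over $k$, and let $S^\ast(L)$ be the symmetric algebra of $L$ equipped with the associative product $\ast$ making it the enveloping algebra of the Lie algebra $L_{Lie}$. For $i\ge 0$ let $sol_i:S^\ast(L)\to S^\ast(L)$ be the canonical projection onto the $i$-th component of the PBW decomposition of $S^\ast(L)$. Let $n\geq 1$ and let $l_1,\dots,l_n\in L$. Then the PBW decomposition of the element $l_1\cdots l_n\in S^\ast(L)$ (symmetric product of $l_1,\dots,l_n$) is given as follows: $$sol_1(l_1\cdots l_n)=\sum_{i=1}^n\frac{(-1)^{i-1}}{i}\sum_{I_1,\dots,I_i}l_{I_1}\ast\cdots\ast l_{I_i},$$ where the inner sum is over all ordered partitions $(I_1,\dots,I_i)$ of $\{1,\dots,n\}$ into $i$ nonempty blocks. More generally, for every $1\le i\le n$, $$sol_i(l_1\cdots l_n)=\sum_{j=i}^n\frac{s(j,i)}{j!}\sum_{I_1,\dots,I_j}l_{I_1}\ast\cdots\ast l_{I_j},$$ where the inner sum is over all ordered partitions $(I_1,\dots,I_j)$ of $\{1,\dots,n\}$ into $j$ nonempty blocks and the $s(j,i)$ are the Stirling numbers of the first kind.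
   Context: A (right) preLie algebra over a field $k$ is a $k$-vector space $L$ with a bilinear map $\curvearrowleft$ such that $(x\curvearrowleft y)\curvearrowleft z-x\curvearrowleft(y\curvearrowleft z)=(x\curvearrowleft z)\curvearrowleft y-x\curvearrowleft(z\curvearrowleft y)$ for all $x,y,z\in L$. The bracket $[x,y]:=x\curvearrowleft y-y\curvearrowleft x$ makes $L$ a Lie algebra, denoted $L_{Lie}$. Symmetric algebra: $S(L)=\bigoplus_{n\ge0}S^n(L)$ is the symmetric algebra of the vector space $L$; the commutative product of $l_1,\dots,l_n\in L$ is written $l_1\cdots l_n$. For $I\subseteq\{1,\dots,n\}$, $l_I:=\prod_{i\in I}l_i$ (symmetric product), with $l_\emptyset=1$. Action of $S(L)$ on $L$: for $a\in L$, the expression $a\curvearrowleft B$ with $B\in S(L)$ is linear in $B$ and determined by $a\curvearrowleft 1=a$, by the preLie product for $B\in L$, and by $$a\curvearrowleft(b_1\cdots b_mb)=(a\curvearrowleft(b_1\cdots b_m))\curvearrowleft b-\sum_{i=1}^m a\curvearrowleft(b_1\cdots(b_i\curvearrowleft b)\cdots b_m)$$ for $b_1,\dots,b_m,b\in L$. With respect to the product $\ast$ below, this is the right action of the enveloping algebra $(S(L),\ast)$ on $L$ extending the preLie product. Product $\ast$: for $a_1,\dots,a_l,b_1,\dots,b_m\in L$, $$(a_1\cdots a_l)\ast(b_1\cdots b_m)=\sum_f B_0\,(a_1\curvearrowleft B_1)\cdots(a_l\curvearrowleft B_l),$$ where the sum is over all functions $f:\{1,\dots,m\}\to\{0,\dots,l\}$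 and $B_i:=\prod_{j\in f^{-1}(i)}b_j$. The product $\ast$ is associative and unital, and $S^\ast(L):=(S(L),\ast)$ is an enveloping algebra of $L_{Lie}$ (a known result). PBW decomposition: the PBW isomorphism is the linear isomorphism $S(L)\to S^\ast(L)$ given by $$l_1\cdots l_n\mapsto\frac1{n!}\sum_{\sigma\in S_n}l_{\sigma(1)}\ast\cdots\ast l_{\sigma(n)}.$$ Let $P_i\subseteq S^\ast(L)$ be the image of $S^i(L)$ under this map, so that $S^\ast(L)=\bigoplus_{i\ge0}P_i$ (note that $P_i$ is in general different from the subspace $S^i(L)$). The map $sol_i$ is the projection of $S^\ast(L)$ onto $P_i$ with kernel $\bigoplus_{j\neq i}P_j$; in particular $sol_1$ is a projection onto $P_1=L$. Stirling numbers of the first kind $s(j,i)$ (signed) are defined by $x(x-1)\cdots(x-j+1)=\sum_{1\le i\le j}s(j,i)x^i$ for $j\geq 1$. *)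

theory Defs
  imports
    "HOL-Library.Poly_Mapping"
    "HOL-Library.Multiset"
    "HOL-Library.FuncSet"
    "HOL-Library.Disjoint_Sets"
    "HOL-Combinatorics.Permutations"
    "HOL-Computational_Algebra.Polynomial"
begin

locale prelie_algebra = L: vector_space scale
  for scale :: "'k::field \<Rightarrow> 'l::ab_group_add \<Rightarrow> 'l" +
  fixes pl :: "'l \<Rightarrow> 'l \<Rightarrow> 'l"  (infixl "\<lhd>" 70)
  assumes linear_left: "Vector_Spaces.linear scale scale (\<lambda>x. x \<lhd> y)"
    and linear_right: "Vector_Spaces.linear scale scale (\<lambda>y. x \<lhd> y)"
    and prelie: "(x \<lhd> y) \<lhd> z - x \<lhd> (y \<lhd> z) = (x \<lhd> z) \<lhd> y - x \<lhd> (z \<lhd> y)"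

text \<open>
  A preLie algebra is free on a set \<open>X\<close> of its elements if the canonical map from the free
  nonassociative algebra on \<open>X\<close> is onto, with kernel the two-sided ideal generated by the preLie
  relations. This presentation replaces the universal property, which would quantify over types.
\<close>

datatype (magma_gens: 'x) magma = Gen 'x | Op "'x magma" "'x magma"

definition nonassoc_algebra :: "'x set \<Rightarrow> ('x magma \<Rightarrow>\<^sub>0 'k::field) set" where
  "nonassoc_algebra X = {p. \<forall>t \<in> Poly_Mapping.keys p. magma_gens t \<subseteq> X}"

definition nonassoc_mult ::
  "('x magma \<Rightarrow>\<^sub>0 'k::field) \<Rightarrow> ('x magma \<Rightarrow>\<^sub>0 'k) \<Rightarrow> ('x magma \<Rightarrow>\<^sub>0 'k)"  (infixl "\<odot>" 70)
  where
  "p \<odot> q = (\<Sum>s \<in> Poly_Mapping.keys p. \<Sum>t \<in> Poly_Mapping.keys q.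
     Poly_Mapping.single (Op s t) (Poly_Mapping.lookup p s * Poly_Mapping.lookup q t))"

inductive_set prelie_ideal :: "'x set \<Rightarrow> ('x magma \<Rightarrow>\<^sub>0 'k::field) set"
  for X :: "'x set" where
  zero: "0 \<in> prelie_ideal X"
| add: "p \<in> prelie_ideal X \<Longrightarrow> q \<in> prelie_ideal X \<Longrightarrow> p + q \<in> prelie_ideal X"
| scale: "p \<in> prelie_ideal X \<Longrightarrow> Poly_Mapping.map ((*) c) p \<in> prelie_ideal X"
| mult_left: "p \<in> prelie_ideal X \<Longrightarrow> r \<in> nonassoc_algebra X \<Longrightarrow> r \<odot> p \<in> prelie_ideal X"
| mult_right: "p \<in> prelie_ideal X \<Longrightarrow> r \<in> nonassoc_algebra X \<Longrightarrow> p \<odot> r \<in> prelie_ideal X"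
| relation: "p \<in> nonassoc_algebra X \<Longrightarrow> q \<in> nonassoc_algebra X \<Longrightarrow> r \<in> nonassoc_algebra X \<Longrightarrow>
    ((p \<odot> q) \<odot> r - p \<odot> (q \<odot> r)) - ((p \<odot> r) \<odot> q - p \<odot> (r \<odot> q)) \<in> prelie_ideal X"

context prelie_algebra
begin

primrec magma_eval :: "'l magma \<Rightarrow> 'l" where
  "magma_eval (Gen x) = x"
| "magma_eval (Op s t) = magma_eval s \<lhd> magma_eval t"

definition nonassoc_eval :: "('l magma \<Rightarrow>\<^sub>0 'k) \<Rightarrow> 'l" where
  "nonassoc_eval p =
     (\<Sum>t \<in> Poly_Mapping.keys p. scale (Poly_Mapping.lookup p t) (magma_eval t))"

definition free_on :: "'l set \<Rightarrow> bool" where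
  "free_on X \<longleftrightarrow>
     nonassoc_eval ` nonassoc_algebra X = UNIV \<and>
     {p \<in> nonassoc_algebra X. nonassoc_eval p = 0} = prelie_ideal X"

end

locale free_prelie_algebra = prelie_algebra scale pl
  for scale :: "'k::field \<Rightarrow> 'l::ab_group_add \<Rightarrow> 'l" and pl :: "'l \<Rightarrow> 'l \<Rightarrow> 'l" +
  assumes free: "\<exists>X. free_on X"

text \<open>
  \<open>'l multiset \<Rightarrow>\<^sub>0 'k\<close> is the polynomial ring with one indeterminate for each vector. Over
  itself, this ring is a module with scalar multiplication \<open>(*)\<close>, and spans are ideals.
\<close>

definition linearity_relations ::
  "('k::field \<Rightarrow> 'l::ab_group_add \<Rightarrow> 'l) \<Rightarrow> ('l multiset \<Rightarrow>\<^sub>0 'k) set" where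
  "linearity_relations scale =
     {Poly_Mapping.single {#x + y#} 1 - Poly_Mapping.single {#x#} 1
        - Poly_Mapping.single {#y#} 1 | x y. True} \<union>
     {Poly_Mapping.single {#scale c x#} 1 - Poly_Mapping.single {#x#} c | c x. True}"

definition poly_eval ::
  "('k::field \<Rightarrow> 's::comm_ring_1 \<Rightarrow> 's) \<Rightarrow> ('l \<Rightarrow> 's) \<Rightarrow> ('l multiset \<Rightarrow>\<^sub>0 'k) \<Rightarrow> 's" where
  "poly_eval scaleS \<iota> p =
     (\<Sum>M \<in> Poly_Mapping.keys p. scaleS (Poly_Mapping.lookup p M) (\<Prod>x \<in># M. \<iota> x))"

text \<open>
  The commutative algebra \<open>'s\<close>, with structure map \<open>\<iota>\<close>, is the symmetric algebra of \<open>'l\<close>, i.e. the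
  free commutative algebra on \<open>'l\<close> modulo the relations making \<open>\<iota>\<close> linear.
\<close>

locale symmetric_algebra = L: vector_space scale + S: vector_space scaleS
  for scale :: "'k::field \<Rightarrow> 'l::ab_group_add \<Rightarrow> 'l"
    and scaleS :: "'k \<Rightarrow> 's::comm_ring_1 \<Rightarrow> 's" +
  fixes \<iota> :: "'l \<Rightarrow> 's"
  assumes scaleS_mult: "scaleS c (x * y) = scaleS c x * y"
    and surj_eval: "surj (poly_eval scaleS \<iota>)"
    and kernel_eval: "{p. poly_eval scaleS \<iota> p = 0} = module.span (*) (linearity_relations scale)"

context symmetric_algebra
begin

definition sym_power :: "nat \<Rightarrow> 's set" where
  "sym_power n = S.span (range (\<lambda>x :: nat \<Rightarrow> 'l. \<Prod>i=1..n. \<iota> (x i)))"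

end

text \<open>
  The objects below are singled out by \<open>THE\<close> among the linear (bilinear) maps with the prescribed
  values on products of elements of \<open>L\<close>. Products over \<open>{1..0}\<close> give the unit of \<open>S(L)\<close>.
\<close>

locale prelie_symmetric =
  prelie_algebra scale pl + symmetric_algebra scale scaleS \<iota>
  for scale :: "'k::field_char_0 \<Rightarrow> 'l::ab_group_add \<Rightarrow> 'l"
    and pl :: "'l \<Rightarrow> 'l \<Rightarrow> 'l"  (infixl "\<lhd>" 70)
    and scaleS :: "'k \<Rightarrow> 's::comm_ring_1 \<Rightarrow> 's"
    and \<iota> :: "'l \<Rightarrow> 's"
begin

definition is_action :: "'l \<Rightarrow> ('s \<Rightarrow> 'l) \<Rightarrow> bool" where
  "is_action a g \<longleftrightarrow>
     Vector_Spaces.linear scaleS scale g \<and>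
     g 1 = a \<and>
     (\<forall>b. g (\<iota> b) = a \<lhd> b) \<and>
     (\<forall>(m::nat) (b::nat \<Rightarrow> 'l) c.
        g ((\<Prod>j=1..m. \<iota> (b j)) * \<iota> c) =
          g (\<Prod>j=1..m. \<iota> (b j)) \<lhd> c - (\<Sum>i=1..m. g (\<Prod>j=1..m. \<iota> ((b(i := b i \<lhd> c)) j))))"

definition action :: "'l \<Rightarrow> 's \<Rightarrow> 'l" where
  "action a = (THE g. is_action a g)"

definition is_star :: "('s \<Rightarrow> 's \<Rightarrow> 's) \<Rightarrow> bool" where
  "is_star mul \<longleftrightarrow>
     (\<forall>y. Vector_Spaces.linear scaleS scaleS (\<lambda>x. mul x y)) \<and>
     (\<forall>x. Vector_Spaces.linear scaleS scaleS (\<lambda>y. mul x y)) \<and>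
     (\<forall>(l::nat) (m::nat) (a::nat \<Rightarrow> 'l) (b::nat \<Rightarrow> 'l).
        mul (\<Prod>i=1..l. \<iota> (a i)) (\<Prod>j=1..m. \<iota> (b j)) =
          (\<Sum>f \<in> {1..m} \<rightarrow>\<^sub>E {0..l}.
             (\<Prod>j \<in> {j \<in> {1..m}. f j = 0}. \<iota> (b j)) *
             (\<Prod>i=1..l. \<iota> (action (a i) (\<Prod>j \<in> {j \<in> {1..m}. f j = i}. \<iota> (b j))))))"

definition star :: "'s \<Rightarrow> 's \<Rightarrow> 's"  (infixl "\<star>" 70) where
  "star = (THE mul. is_star mul)"

definition star_list :: "'s list \<Rightarrow> 's" where
  "star_list xs = foldl (\<star>) 1 xs"

definition is_pbw :: "('s \<Rightarrow> 's) \<Rightarrow> bool" where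
  "is_pbw e \<longleftrightarrow>
     Vector_Spaces.linear scaleS scaleS e \<and>
     (\<forall>(n::nat) (l::nat \<Rightarrow> 'l).
        e (\<Prod>i=1..n. \<iota> (l i)) =
          scaleS (1 / fact n)
            (\<Sum>\<sigma> | \<sigma> permutes {1..n}. star_list (map (\<lambda>i. \<iota> (l (\<sigma> i))) [1..<Suc n])))"

definition pbw :: "'s \<Rightarrow> 's" where
  "pbw = (THE e. is_pbw e)"

definition pbw_component :: "nat \<Rightarrow> 's set" where
  "pbw_component i = pbw ` sym_power i"

definition is_sol :: "nat \<Rightarrow> ('s \<Rightarrow> 's) \<Rightarrow> bool" where
  "is_sol i p \<longleftrightarrow>
     Vector_Spaces.linear scaleS scaleS p \<and>
     (\<forall>x. p (p x) = p x) \<and>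
     range p = pbw_component i \<and>
     {x. p x = 0} = S.span (\<Union>j \<in> - {i}. pbw_component j)"

definition sol :: "nat \<Rightarrow> 's \<Rightarrow> 's" where
  "sol i = (THE p. is_sol i p)"

end

text \<open>The library's \<open>stirling\<close> is the unsigned version.\<close>

definition signed_stirling1 :: "nat \<Rightarrow> nat \<Rightarrow> int" where
  "signed_stirling1 j i = coeff (\<Prod>m<j. [:- int m, 1:]) i"

definition ordered_partitions :: "'a set \<Rightarrow> nat \<Rightarrow> 'a set list set" where
  "ordered_partitions A j = {Is. length Is = j \<and> distinct Is \<and> partition_on A (set Is)}"

end

theory Submission
  imports Defs
begin

text \<open>
  For \<open>b \<in> L\<close> let \<open>T b X = b X + D\<^sub>b X\<close>, where \<open>D\<^sub>b\<close> is the derivation of \<open>S(L)\<close> extending \<open>x \<mapsto> x \<lhd> b\<close>.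
  These operators generate \<open>S(L)\<close> from \<open>1\<close>, and a right \<open>L\<close>-module structure extends to all of \<open>S(L)\<close>
  by letting \<open>T b X\<close> act as \<open>X\<close> followed by \<open>b\<close>. Applied to \<open>L\<close> this gives the action, and applied to
  \<open>S(L)\<close> itself with the operators \<open>T b\<close> it gives \<open>\<star>\<close>.

  Let \<open>\<Psi>\<^sup>k\<close> be the \<open>k\<close>-th convolution power of the identity with respect to \<open>\<star>\<close> and the unshuffling coproduct.
  Since \<open>L\<close> is primitive, \<open>\<Psi>\<^sup>k\<close> multiplies the \<open>n\<close>-th power of \<open>l \<in> L\<close> for \<open>\<star>\<close> by \<open>k ^ n\<close>; by polarization these
  powers span \<open>P\<^sub>n\<close>. On the other hand, \<open>\<Psi>\<^sup>k = (\<Sum>j. (k choose j) Q\<^sub>j)\<close>, where \<open>Q\<^sub>j\<close> is the sum over ordered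
  partitions into \<open>j\<close> blocks, so expanding \<open>k choose j\<close> in powers of \<open>k\<close> by Stirling numbers gives
  \<open>\<Psi>\<^sup>k = (\<Sum>i. k ^ i E\<^sub>i)\<close> with \<open>E\<^sub>i\<close> the map of the theorem. Comparing the coefficients of \<open>k ^ i\<close>
  identifies \<open>E\<^sub>i\<close> with the projection onto \<open>P\<^sub>i\<close>.
\<close>

subsection \<open>The universal property of the symmetric algebra\<close>

text \<open>The formula of \<open>poly_eval\<close> with arbitrary vectors in place of products. The
  target need only be a vector space, so that linear maps out of S(L) can be defined on the
  polynomial ring without being multiplicative.\<close>

definition lincomb ::
  "('k \<Rightarrow> 'v::ab_group_add \<Rightarrow> 'v) \<Rightarrow> ('i \<Rightarrow> 'v) \<Rightarrow> ('i \<Rightarrow>\<^sub>0 'k::field) \<Rightarrow> 'v" where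
  "lincomb s \<phi> p = (\<Sum>i \<in> Poly_Mapping.keys p. s (Poly_Mapping.lookup p i) (\<phi> i))"

context
  fixes s :: "'k::field \<Rightarrow> 'v::ab_group_add \<Rightarrow> 'v"
  assumes s: "vector_space s"
begin

interpretation V: vector_space s by (rule s)

lemma lincomb_superset:
  assumes "finite I" "Poly_Mapping.keys p \<subseteq> I"
  shows "lincomb s \<phi> p = (\<Sum>i\<in>I. s (Poly_Mapping.lookup p i) (\<phi> i))"
  unfolding lincomb_def
  by (rule sum.mono_neutral_left) (use assms in \<open>auto simp: in_keys_iff\<close>)

lemma lincomb_single: "lincomb s \<phi> (Poly_Mapping.single i c) = s c (\<phi> i)"
  by (cases "c = 0") (simp_all add: lincomb_def)

lemma lincomb_add: "lincomb s \<phi> (p + q) = lincomb s \<phi> p + lincomb s \<phi> q"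
proof -
  let ?I = "Poly_Mapping.keys p \<union> Poly_Mapping.keys q"
  have "lincomb s \<phi> (p + q) = (\<Sum>i\<in>?I. s (Poly_Mapping.lookup (p + q) i) (\<phi> i))"
    by (rule lincomb_superset) (auto dest: Poly_Mapping.keys_add[THEN subsetD])
  also have "\<dots> = lincomb s \<phi> p + lincomb s \<phi> q"
    by (simp add: lincomb_superset[of ?I] lookup_add V.scale_left_distrib sum.distrib)
  finally show ?thesis .
qed

lemma lincomb_diff: "lincomb s \<phi> (p - q) = lincomb s \<phi> p - lincomb s \<phi> q"
  using lincomb_add[of \<phi> "p - q" q] by simp

lemma lincomb_sum: "lincomb s \<phi> (sum f A) = (\<Sum>a\<in>A. lincomb s \<phi> (f a))"
  by (induction A rule: infinite_finite_induct) (simp_all add: lincomb_add, simp_all add: lincomb_def)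

lemma lincomb_scale: "lincomb s \<phi> (Poly_Mapping.map ((*) c) p) = s c (lincomb s \<phi> p)"
  by (subst lincomb_superset[of "Poly_Mapping.keys p"])
    (auto simp: lincomb_def in_keys_iff Poly_Mapping.map.rep_eq when_def V.scale_sum_right split: if_splits
      intro!: sum.cong)

end

lemma sum_single_lookup:
  "(\<Sum>i\<in>Poly_Mapping.keys p. Poly_Mapping.single i (Poly_Mapping.lookup p i)) = p"
  by (rule poly_mapping_eqI)
    (auto simp: lookup_sum lookup_single when_def sum.delta not_in_keys_iff_lookup_eq_zero)

lemma module_mult: "module ((*) :: 'a::comm_ring_1 \<Rightarrow> 'a \<Rightarrow> 'a)"
  by unfold_locales (simp_all add: algebra_simps)

context symmetric_algebra
begin

definition monomial :: "'l multiset \<Rightarrow> 's" where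
  "monomial M = (\<Prod>x\<in>#M. \<iota> x)"

text \<open>A function on multisets is symmetric by its type, so linearity in one slot suffices:
  such a \<open>\<phi>\<close> is a family of symmetric multilinear maps, one for each
  degree.\<close>

definition multilinear :: "('k \<Rightarrow> 'v::ab_group_add \<Rightarrow> 'v) \<Rightarrow> ('l multiset \<Rightarrow> 'v) \<Rightarrow> bool" where
  "multilinear scaleV \<phi> \<longleftrightarrow>
     (\<forall>M x y. \<phi> (add_mset (x + y) M) = \<phi> (add_mset x M) + \<phi> (add_mset y M)) \<and>
     (\<forall>M c x. \<phi> (add_mset (scale c x) M) = scaleV c (\<phi> (add_mset x M)))"

lemma monomial_simps [simp]:
  "monomial {#} = 1" "monomial (add_mset x M) = \<iota> x * monomial M"
  by (simp_all add: monomial_def)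

lemma poly_eval_eq_lincomb: "poly_eval scaleS \<iota> = lincomb scaleS monomial"
  by (simp add: fun_eq_iff poly_eval_def lincomb_def monomial_def)

text \<open>The span is an ideal, whereas \<open>lincomb scaleV \<phi>\<close> is only linear. Hence
  the induction is over the stronger claim that all multiples \<open>q * p\<close> vanish; monomial
  multiples of a relation vanish by multilinearity.\<close>

lemma lincomb_relations_eq_0:
  assumes V: "vector_space scaleV" and \<phi>: "multilinear scaleV \<phi>"
    and p: "p \<in> module.span (*) (linearity_relations scale)"
  shows "lincomb scaleV \<phi> p = 0"
proof -
  interpret V: vector_space scaleV by fact
  interpret P: module "(*) :: ('l multiset \<Rightarrow>\<^sub>0 'k) \<Rightarrow> _ \<Rightarrow> _" by (rule module_mult)
  have "\<forall>q. lincomb scaleV \<phi> (q * p) = 0"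
    using p
  proof (induction rule: P.span_induct)
    case base
    show ?case
      by (rule P.subspaceI)
        (auto simp: distrib_left lincomb_add[OF V] lincomb_def[of _ _ 0] simp flip: mult.assoc)
  next
    case (step r)
    have mono: "lincomb scaleV \<phi> (Poly_Mapping.single N c * r) = 0" for N c
      using step \<phi> unfolding linearity_relations_def multilinear_def
      by (auto simp: right_diff_distrib mult_single lincomb_diff[OF V] lincomb_single[OF V] V.scale_right_distrib
          mult.commute)
    show ?case
    proof
      fix q :: "'l multiset \<Rightarrow>\<^sub>0 'k"
      have "q * r = (\<Sum>N\<in>Poly_Mapping.keys q. Poly_Mapping.single N (Poly_Mapping.lookup q N) * r)"
        by (simp add: sum_single_lookup flip: sum_distrib_right)
      then show "lincomb scaleV \<phi> (q * r) = 0"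
        by (simp add: lincomb_sum[OF V] mono)
    qed
  qed
  from this[rule_format, of 1] show ?thesis by simp
qed

lemma lincomb_monomial_surj: "\<exists>p. lincomb scaleS monomial p = s"
  using surj_eval unfolding poly_eval_eq_lincomb by (metis surjD)

text \<open>Universal property for linear maps: \<open>\<phi>\<close> is evaluated on any polynomial
  representing the given element. Two representatives differ by an element of the ideal, where
  \<open>lincomb_relations_eq_0\<close> applies.\<close>

lemma sym_lift:
  assumes V: "vector_space scaleV" and \<phi>: "multilinear scaleV \<phi>"
  obtains g where "Vector_Spaces.linear scaleS scaleV g" "\<And>M. g (monomial M) = \<phi> M"
proof -
  interpret V: vector_space scaleV by fact
  define rep where "rep s = (SOME p. lincomb scaleS monomial p = s)" for s
  have rep: "lincomb scaleS monomial (rep s) = s" for s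
    unfolding rep_def by (rule someI_ex) (rule lincomb_monomial_surj)
  define g where "g s = lincomb scaleV \<phi> (rep s)" for s
  have g: "g (lincomb scaleS monomial p) = lincomb scaleV \<phi> p" for p
  proof -
    have "poly_eval scaleS \<iota> (rep (lincomb scaleS monomial p) - p) = 0"
      by (simp add: poly_eval_eq_lincomb lincomb_diff[OF S.vector_space_axioms] rep)
    then have "rep (lincomb scaleS monomial p) - p \<in> module.span (*) (linearity_relations scale)"
      using kernel_eval by blast
    from lincomb_relations_eq_0[OF V \<phi> this] show ?thesis
      by (simp add: g_def lincomb_diff[OF V])
  qed
  have "g (x + y) = g x + g y" for x y
    using g[of "rep x + rep y"]
    by (simp add: rep g_def lincomb_add[OF S.vector_space_axioms] lincomb_add[OF V])
  moreover have "g (scaleS c x) = scaleV c (g x)" for c x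
  proof -
    show ?thesis
      using g[of "Poly_Mapping.map ((*) c) (rep x)"]
      by (simp add: rep g_def lincomb_scale[OF V] lincomb_scale[OF S.vector_space_axioms])
  qed
  ultimately have "Vector_Spaces.linear scaleS scaleV g"
    using V S.vector_space_axioms by (simp add: Vector_Spaces.linear_iff)
  moreover have "g (monomial M) = \<phi> M" for M
    using g[of "Poly_Mapping.single M 1"]
    by (simp add: lincomb_single[OF V] lincomb_single[OF S.vector_space_axioms])
  ultimately show thesis by (rule that)
qed

lemma iota_add: "\<iota> (x + y) = \<iota> x + \<iota> y"
  and iota_scale: "\<iota> (scale c x) = scaleS c (\<iota> x)"
proof -
  interpret P: module "(*) :: ('l multiset \<Rightarrow>\<^sub>0 'k) \<Rightarrow> _ \<Rightarrow> _" by (rule module_mult)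
  have *: "lincomb scaleS monomial r = 0" if "r \<in> linearity_relations scale" for r
    using kernel_eval P.span_base[OF that] unfolding poly_eval_eq_lincomb by auto
  have "lincomb scaleS monomial (Poly_Mapping.single {#x + y#} 1 - Poly_Mapping.single {#x#} 1
      - Poly_Mapping.single {#y#} 1) = 0"
    by (rule *) (auto simp: linearity_relations_def)
  then show "\<iota> (x + y) = \<iota> x + \<iota> y"
    by (simp add: lincomb_diff[OF S.vector_space_axioms] lincomb_single[OF S.vector_space_axioms])
      (simp add: algebra_simps)
  have "lincomb scaleS monomial (Poly_Mapping.single {#scale c x#} 1 - Poly_Mapping.single {#x#} c) = 0"
    by (rule *) (auto simp: linearity_relations_def)
  then show "\<iota> (scale c x) = scaleS c (\<iota> x)"
    by (simp add: lincomb_diff[OF S.vector_space_axioms] lincomb_single[OF S.vector_space_axioms])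
qed

lemma span_monomials: "S.span (range monomial) = UNIV"
proof -
  have "s \<in> S.span (range monomial)" for s
  proof -
    obtain p where "lincomb scaleS monomial p = s" using lincomb_monomial_surj by blast
    then show ?thesis
      by (auto simp: lincomb_def intro!: S.span_sum intro: S.span_scale S.span_base)
  qed
  then show ?thesis by blast
qed

lemma scaleS_mult_right: "x * scaleS c y = scaleS c (x * y)"
  by (metis scaleS_mult mult.commute)

lemma linear_eqI:
  assumes "Vector_Spaces.linear scaleS scaleV f" "Vector_Spaces.linear scaleS scaleV g"
    and "\<And>M. f (monomial M) = g (monomial M)"
  shows "f = g"
proof
  fix s
  interpret f: Vector_Spaces.linear scaleS scaleV f by fact
  interpret vector_space_pair scaleS scaleV ..
  show "f s = g s"
    by (rule linear_eq_on[of f g s "range monomial"]) (use assms span_monomials in auto)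
qed

end

section \<open>Induction over products, derivations, and linear maps built one factor at a
  time\<close>

context symmetric_algebra
begin

lemma sym_induct [case_names one add scale mult]:
  assumes one: "P 1"
    and add: "\<And>X Y. P X \<Longrightarrow> P Y \<Longrightarrow> P (X + Y)"
    and scale: "\<And>c X. P X \<Longrightarrow> P (scaleS c X)"
    and mult: "\<And>x X. P X \<Longrightarrow> P (\<iota> x * X)"
  shows "P X"
proof -
  have "X \<in> S.span (range monomial)" by (simp add: span_monomials)
  then show ?thesis
  proof (induction rule: S.span_induct)
    case base
    have "P 0" using scale[OF one, of 0] by simp
    then show ?case using add scale by (auto intro: S.subspaceI)
  next
    case (step x)
    then obtain M where "x = monomial M" by blast
    moreover have "P (monomial M)" by (induction M) (simp_all add: one mult)
    ultimately show ?case by simp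
  qed
qed

lemma linear_S_iff:
  "Vector_Spaces.linear scaleS scaleV f \<longleftrightarrow>
    vector_space scaleV \<and> (\<forall>X Y. f (X + Y) = f X + f Y) \<and> (\<forall>c X. f (scaleS c X) = scaleV c (f X))"
  using S.vector_space_axioms by (auto simp: Vector_Spaces.linear_iff)

lemma monomial_image: "finite A \<Longrightarrow> monomial (image_mset l (mset_set A)) = (\<Prod>j\<in>A. \<iota> (l j))"
  unfolding monomial_def by (simp add: prod_unfold_prod_mset image_mset.compositionality comp_def)

lemma monomial_as_prod:
  obtains l :: "nat \<Rightarrow> 'l"
  where "M = image_mset l (mset_set {1..size M})" "monomial M = (\<Prod>j=1..size M. \<iota> (l j))"
proof -
  obtain xs where xs: "mset xs = M" using ex_mset by blast
  define l where "l j = xs ! (j - 1)" for j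
  have "xs = map l [1..<Suc (length xs)]"
    by (rule nth_equalityI) (simp_all add: l_def del: upt_Suc)
  then have "M = image_mset l (mset_set {1..size M})"
    by (metis xs mset_map mset_upt size_mset atLeastLessThanSuc_atLeastAtMost)
  then show thesis
    using that monomial_image[of "{1..size M}" l] by simp
qed

text \<open>The Leibniz formula on monomials is multilinear, which gives \<open>D\<close>. The
  product rule is proved first for a left factor from L and then extended by induction on the left
  factor.\<close>

lemma derivation_lift:
  assumes r: "\<And>x y. r (x + y) = r x + r y" "\<And>c x. r (scale c x) = scale c (r x)"
  obtains D where "Vector_Spaces.linear scaleS scaleS D" "\<And>x. D (\<iota> x) = \<iota> (r x)"
    "\<And>X Y. D (X * Y) = D X * Y + X * D Y"
proof -
  define \<phi> where "\<phi> M = (\<Sum>x\<in>#M. \<iota> (r x) * monomial (M - {#x#}))" for M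
  have \<phi>_add: "\<phi> (add_mset y M) = \<iota> (r y) * monomial M + \<iota> y * \<phi> M" for y M
  proof -
    have "(\<Sum>x\<in>#M. \<iota> (r x) * monomial (add_mset y M - {#x#})) =
      (\<Sum>x\<in>#M. \<iota> y * (\<iota> (r x) * monomial (M - {#x#})))"
      by (intro arg_cong[of _ _ sum_mset] image_mset_cong) (simp add: algebra_simps)
    then show ?thesis by (simp add: \<phi>_def sum_mset_distrib_left)
  qed
  have "multilinear scaleS \<phi>"
    by (simp add: multilinear_def \<phi>_add r iota_add iota_scale scaleS_mult[symmetric]
        S.scale_right_distrib distrib_right)
  then obtain D where D: "Vector_Spaces.linear scaleS scaleS D" "\<And>M. D (monomial M) = \<phi> M"
    using sym_lift[OF S.vector_space_axioms] by blast
  have lin: "D (X + Y) = D X + D Y" "D (scaleS c X) = scaleS c (D X)" for X Y c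
    using D(1) by (simp_all add: linear_S_iff)
  have 1: "D 1 = 0" using D(2)[of "{#}"] by (simp add: \<phi>_def)
  have x: "D (\<iota> x) = \<iota> (r x)" for x
    using D(2)[of "{#x#}"] by (simp add: \<phi>_add \<phi>_def)
  have xX: "D (\<iota> x * X) = \<iota> (r x) * X + \<iota> x * D X" for x X
  proof -
    have "(\<lambda>X. D (\<iota> x * X)) = (\<lambda>X. \<iota> (r x) * X + \<iota> x * D X)"
    proof (rule linear_eqI[where scaleV = scaleS])
      show "D (\<iota> x * monomial M) = \<iota> (r x) * monomial M + \<iota> x * D (monomial M)" for M
        using D(2)[of "add_mset x M"] by (simp add: D(2) \<phi>_add)
    qed (simp_all add: linear_S_iff S.vector_space_axioms lin distrib_left scaleS_mult_right
        S.scale_right_distrib)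
    then show ?thesis by metis
  qed
  have "D (X * Y) = D X * Y + X * D Y" for X Y
  proof (induction X rule: sym_induct)
    case one then show ?case by (simp add: 1)
  next
    case (add X Z) then show ?case by (simp add: lin algebra_simps)
  next
    case (scale c X) then show ?case
      by (simp add: lin S.scale_right_distrib flip: scaleS_mult)
  next
    case (mult x X) then show ?case by (simp add: xX mult.assoc) (simp add: algebra_simps)
  qed
  with D(1) x show thesis by (rule that)
qed

text \<open>The value on a monomial is prescribed after splitting off one factor. By
  \<open>sym\<close> the choice of this factor does not matter, so an arbitrary choice yields a
  function on multisets.\<close>

lemma lift_step:
  fixes v :: "'v::ab_group_add"
  assumes V: "vector_space scaleV"
    and u1: "\<And>x y X. u (x + y) X = u x X + u y X" "\<And>c x X. u (scale c x) X = scaleV c (u x X)"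
    and u2: "\<And>x X Y. u x (X + Y) = u x X + u x Y" "\<And>c x X. u x (scaleS c X) = scaleV c (u x X)"
    and sym: "\<And>x y X. u x (\<iota> y * X) = u y (\<iota> x * X)"
  obtains h where "Vector_Spaces.linear scaleS scaleV h" "h 1 = v" "\<And>x X. h (\<iota> x * X) = u x X"
proof -
  define \<phi> where "\<phi> M = (if M = {#} then v
    else let x = SOME x. x \<in># M in u x (monomial (M - {#x#})))" for M
  have \<phi>: "\<phi> (add_mset x M) = u x (monomial M)" for x M
  proof -
    define y where "y = (SOME y. y \<in># add_mset x M)"
    have "y \<in># add_mset x M" unfolding y_def by (rule someI_ex) auto
    then have "u y (monomial (add_mset x M - {#y#})) = u x (monomial M)"
    proof (cases "y = x")
      case False
      with \<open>y \<in># add_mset x M\<close> obtain N where "M = add_mset y N"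
        by (auto dest: multi_member_split)
      with False show ?thesis by (simp add: sym[of y])
    qed simp
    then show ?thesis
      unfolding \<phi>_def Let_def y_def[symmetric] by simp
  qed
  have "multilinear scaleV \<phi>" by (simp add: multilinear_def \<phi> u1)
  then obtain h where h: "Vector_Spaces.linear scaleS scaleV h" "\<And>M. h (monomial M) = \<phi> M"
    using sym_lift[OF V] by blast
  show thesis
  proof
    show "Vector_Spaces.linear scaleS scaleV h" by fact
    show "h 1 = v" using h(2)[of "{#}"] by (simp add: \<phi>_def)
    show "h (\<iota> x * X) = u x X" for x X
    proof -
      have "(\<lambda>X. h (\<iota> x * X)) = u x"
        using h(2)[of "add_mset x _"] h(1)
        by (intro linear_eqI[where scaleV = scaleV]) (simp_all add: linear_S_iff V u2 \<phi> distrib_left scaleS_mult_right)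
      then show ?thesis by metis
    qed
  qed
qed

lemma linear_monomial_span_eq:
  assumes "Vector_Spaces.linear scaleS scaleV f" "Vector_Spaces.linear scaleS scaleV g"
    and "\<And>M. size M = n \<Longrightarrow> f (monomial M) = g (monomial M)"
    and "X \<in> S.span (monomial ` {M. size M = n})"
  shows "f X = g X"
  using assms(4)
proof (induction rule: S.span_induct)
  case base
  interpret f: Vector_Spaces.linear scaleS scaleV f by fact
  interpret g: Vector_Spaces.linear scaleS scaleV g by fact
  show ?case by (rule S.subspaceI) (simp_all add: f.add f.scale g.add g.scale)
qed (use assms(3) in auto)

end

context prelie_symmetric
begin

lemma pl_add_left: "(x + y) \<lhd> z = x \<lhd> z + y \<lhd> z"
  and pl_scale_left: "scale c x \<lhd> z = scale c (x \<lhd> z)"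
  and pl_add_right: "z \<lhd> (x + y) = z \<lhd> x + z \<lhd> y"
  and pl_scale_right: "z \<lhd> scale c x = scale c (z \<lhd> x)"
  using linear_left[of z] linear_right[of z] by (simp_all add: Vector_Spaces.linear_iff)

subsection \<open>Right modules over the enveloping algebra\<close>

definition der :: "'l \<Rightarrow> 's \<Rightarrow> 's" where
  "der b = (SOME D. Vector_Spaces.linear scaleS scaleS D \<and> (\<forall>x. D (\<iota> x) = \<iota> (x \<lhd> b)) \<and>
     (\<forall>X Y. D (X * Y) = D X * Y + X * D Y))"

lemma der: "Vector_Spaces.linear scaleS scaleS (der b)" (is ?lin)
  and der_iota [simp]: "der b (\<iota> x) = \<iota> (x \<lhd> b)" (is ?iota)
  and der_mult: "der b (X * Y) = der b X * Y + X * der b Y" (is ?mult)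
proof -
  obtain D where "Vector_Spaces.linear scaleS scaleS D" "\<And>x. D (\<iota> x) = \<iota> (x \<lhd> b)"
    "\<And>X Y. D (X * Y) = D X * Y + X * D Y"
    by (rule derivation_lift[of "\<lambda>x. x \<lhd> b"]) (use pl_add_left pl_scale_left in auto)
  then have "\<exists>D. Vector_Spaces.linear scaleS scaleS D \<and> (\<forall>x. D (\<iota> x) = \<iota> (x \<lhd> b)) \<and>
     (\<forall>X Y. D (X * Y) = D X * Y + X * D Y)" by blast
  from someI_ex[OF this] show ?lin ?iota ?mult unfolding der_def by blast+
qed

lemma der_add: "der b (X + Y) = der b X + der b Y"
  and der_scale: "der b (scaleS c X) = scaleS c (der b X)"
  using der[of b] by (simp_all add: linear_S_iff)

lemma der_one [simp]: "der b 1 = 0"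
  using der_mult[of b 1 1] by simp

lemma der_add_left: "der (b + c) X = der b X + der c X"
  by (induction X rule: sym_induct)
    (simp_all add: der_add der_scale der_mult pl_add_right iota_add S.scale_right_distrib algebra_simps)

lemma der_scale_left: "der (scale c b) X = scaleS c (der b X)"
  by (induction X rule: sym_induct)
    (simp_all add: der_add der_scale der_mult pl_scale_right iota_scale S.scale_right_distrib
      scaleS_mult_right mult.commute flip: scaleS_mult)

text \<open>On elements of L this is the preLie identity. It propagates to products because the
  mixed terms of the product rule are symmetric in \<open>c\<close> and \<open>d\<close>.\<close>

lemma der_commute: "der c (der d X) + der (c \<lhd> d) X = der d (der c X) + der (d \<lhd> c) X"
proof (induction X rule: sym_induct)
  case (add X Y)
  then show ?case by (simp add: der_add algebra_simps)
next
  case (scale a X)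
  then show ?case by (simp add: der_scale flip: S.scale_right_distrib)
next
  case (mult x X)
  have "(x \<lhd> d) \<lhd> c + x \<lhd> (c \<lhd> d) = (x \<lhd> c) \<lhd> d + x \<lhd> (d \<lhd> c)"
    using prelie[of x c d] by (simp add: algebra_simps)
  then have x: "\<iota> ((x \<lhd> d) \<lhd> c) + \<iota> (x \<lhd> (c \<lhd> d)) = \<iota> ((x \<lhd> c) \<lhd> d) + \<iota> (x \<lhd> (d \<lhd> c))"
    by (metis iota_add)
  have "der c (der d (\<iota> x * X)) + der (c \<lhd> d) (\<iota> x * X) =
    (\<iota> ((x \<lhd> d) \<lhd> c) + \<iota> (x \<lhd> (c \<lhd> d))) * X + \<iota> x * (der c (der d X) + der (c \<lhd> d) X)
      + (\<iota> (x \<lhd> d) * der c X + \<iota> (x \<lhd> c) * der d X)"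
    by (simp add: der_mult der_add algebra_simps)
  also have "\<dots> = der d (der c (\<iota> x * X)) + der (d \<lhd> c) (\<iota> x * X)"
    unfolding x mult by (simp add: der_mult der_add algebra_simps)
  finally show ?case .
qed (use der_scale[of _ 0 0] in simp)

lemma der_prod:
  assumes "finite A"
  shows "der c (\<Prod>j\<in>A. \<iota> (l j)) = (\<Sum>i\<in>A. \<Prod>j\<in>A. \<iota> ((l(i := l i \<lhd> c)) j))"
  using assms
proof (induction A rule: finite_induct)
  case (insert a A)
  have "(\<Prod>j\<in>A. \<iota> ((l(a := l a \<lhd> c)) j)) = (\<Prod>j\<in>A. \<iota> (l j))"
    using insert.hyps by (intro prod.cong) auto
  moreover have "(\<Sum>i\<in>A. \<iota> ((l(i := l i \<lhd> c)) a) * (\<Prod>j\<in>A. \<iota> ((l(i := l i \<lhd> c)) j))) =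
    (\<Sum>i\<in>A. \<iota> (l a) * (\<Prod>j\<in>A. \<iota> ((l(i := l i \<lhd> c)) j)))"
    using insert.hyps by (intro sum.cong) auto
  ultimately show ?case
    using insert by (simp add: der_mult sum_distrib_left)
qed simp

lemma der_monomial: "der b (monomial M) \<in> S.span (monomial ` {N. size N = size M})"
proof -
  obtain l where l: "monomial M = (\<Prod>j=1..size M. \<iota> (l j))"
    by (rule monomial_as_prod)
  have "(\<Prod>j=1..size M. \<iota> (l' j)) \<in> monomial ` {N. size N = size M}" for l'
    by (rule image_eqI[of _ _ "image_mset l' (mset_set {1..size M})"]) (simp_all add: monomial_image)
  then show ?thesis
    unfolding l by (simp only: der_prod finite_atLeastAtMost) (intro S.span_sum S.span_base)
qed

definition T :: "'l \<Rightarrow> 's \<Rightarrow> 's" where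
  "T b X = \<iota> b * X + der b X"

lemma T_one [simp]: "T b 1 = \<iota> b"
  by (simp add: T_def)

lemma T_add: "T b (X + Y) = T b X + T b Y"
  and T_scale: "T b (scaleS c X) = scaleS c (T b X)"
  by (simp_all add: T_def der_add der_scale algebra_simps scaleS_mult_right S.scale_right_distrib)

lemma T_linear: "Vector_Spaces.linear scaleS scaleS (T b)"
  by (simp add: linear_S_iff S.vector_space_axioms T_add T_scale)

lemma T_add_left: "T (b + c) X = T b X + T c X"
  and T_scale_left: "T (scale a b) X = scaleS a (T b X)"
  by (simp_all add: T_def der_add_left der_scale_left iota_add iota_scale distrib_right
      S.scale_right_distrib flip: scaleS_mult)

text \<open>This is the axiom \<open>comm\<close> of \<open>module_lift\<close> for S(L) itself. The
  product rule contributes \<open>\<iota> (d \<lhd> c) * X\<close> and the second summand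
  \<open>\<iota> (c \<lhd> d) * X\<close>, so the left side is symmetric up to
  \<open>der_commute\<close>.\<close>

lemma T_commute: "T c (T d X) + T (c \<lhd> d) X = T d (T c X) + T (d \<lhd> c) X"
  using der_commute[of c d X] by (simp add: T_def der_mult der_add algebra_simps)

text \<open>\<open>T b X\<close> differs from \<open>\<iota> b * X\<close> by
  \<open>der b X\<close>, which raises no degree, so induction on the degree reaches all monomials.
  Consequently a linear map is determined by its value at 1 and its behaviour under the operators
  \<open>T b\<close>.\<close>

lemma T_induct [case_names one add scale T]:
  assumes one: "P 1"
    and add: "\<And>X Y. P X \<Longrightarrow> P Y \<Longrightarrow> P (X + Y)"
    and scale: "\<And>c X. P X \<Longrightarrow> P (scaleS c X)"
    and T: "\<And>b X. P X \<Longrightarrow> P (T b X)"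
  shows "P X"
proof -
  have "P 0" using scale[OF one, of 0] by simp
  then have sub: "S.subspace (Collect P)" using add scale by (auto intro: S.subspaceI)
  have mono: "P (monomial M)" for M
  proof (induction "size M" arbitrary: M)
    case 0 then show ?case by (simp add: one)
  next
    case (Suc n)
    then obtain b N where M: "M = add_mset b N" and N: "size N = n"
      by (metis size_eq_Suc_imp_eq_union size_add_mset add_left_cancel plus_1_eq_Suc)
    have "S.span (monomial ` {N. size N = n}) \<subseteq> Collect P"
      using Suc.hyps(1) sub by (intro S.span_minimal) auto
    then have "P (der b (monomial N))" using der_monomial[of b N] N by auto
    moreover have "P (T b (monomial N))" using N Suc.hyps(1) T by blast
    ultimately have "T b (monomial N) - der b (monomial N) \<in> Collect P"
      by (intro S.subspace_diff[OF sub]) auto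
    then show ?case by (simp add: M T_def)
  qed
  have "S.span (range monomial) \<subseteq> Collect P"
    using mono sub by (intro S.span_minimal) auto
  then show ?thesis by (auto simp: span_monomials)
qed

text \<open>
  With \<open>T b X\<close> in the role of \<open>X \<star> \<iota> b\<close>, the module axiom of the enveloping algebra is the
  identity \<open>comm\<close>. The degree \<open>n\<close> parts \<open>h n\<close> of the action on \<open>v\<close> are built one after the other.
\<close>

lemma module_lift:
  fixes v :: "'v::ab_group_add"
  assumes V: "vector_space scaleV"
    and \<rho>1: "\<And>b c v. \<rho> (b + c) v = \<rho> b v + \<rho> c v" "\<And>a b v. \<rho> (scale a b) v = scaleV a (\<rho> b v)"
    and \<rho>2: "\<And>b v w. \<rho> b (v + w) = \<rho> b v + \<rho> b w" "\<And>a b v. \<rho> b (scaleV a v) = scaleV a (\<rho> b v)"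
    and comm: "\<And>c d v. \<rho> c (\<rho> d v) + \<rho> (c \<lhd> d) v = \<rho> d (\<rho> c v) + \<rho> (d \<lhd> c) v"
  obtains g where "Vector_Spaces.linear scaleS scaleV g" "g 1 = v" "\<And>b X. g (T b X) = \<rho> b (g X)"
proof -
  interpret V: vector_space scaleV by fact
  have \<rho>_diff: "\<rho> b (v - w) = \<rho> b v - \<rho> b w" for b v w
    using \<rho>2(1)[of b "v - w" w] by simp
  \<comment> \<open>The last clause is the hypothesis \<open>sym\<close> of \<open>lift_step\<close>
    for the next degree; it is carried along the recursion.\<close>
  define P where "P n h \<longleftrightarrow> Vector_Spaces.linear scaleS scaleV h \<and> (n = 0 \<longrightarrow> h 1 = v) \<and>
    (\<forall>c d X. \<rho> c (h (\<iota> d * X)) - h (der c (\<iota> d * X)) = \<rho> d (h (\<iota> c * X)) - h (der d (\<iota> c * X)))"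
    for n :: nat and h
  \<comment> \<open>This is the desired equation \<open>g (T b X) = \<rho> b (g X)\<close> solved
    for its term of highest degree, \<open>g (\<iota> b * X)\<close>.\<close>
  have "\<exists>h. \<forall>n. P n (h n) \<and> (\<forall>b X. h (Suc n) (\<iota> b * X) = \<rho> b (h n X) - h n (der b X))"
  proof (rule dependent_nat_choice)
    obtain h where h: "Vector_Spaces.linear scaleS scaleV h" "h 1 = v" "\<And>b X. h (\<iota> b * X) = 0"
      by (rule lift_step[OF V, of "\<lambda>_ _. 0" v]) auto
    interpret h: Vector_Spaces.linear scaleS scaleV h by fact
    have "\<rho> b 0 = 0" for b using \<rho>_diff[of b 0 0] by simp
    then show "\<exists>h. P 0 h"
      using h by (auto simp: P_def der_mult h.add)
  next
    fix h n assume "P n h"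
    then have lin: "Vector_Spaces.linear scaleS scaleV h"
      and sym: "\<And>c d X. \<rho> c (h (\<iota> d * X)) - h (der c (\<iota> d * X)) =
        \<rho> d (h (\<iota> c * X)) - h (der d (\<iota> c * X))"
      unfolding P_def by blast+
    interpret h: Vector_Spaces.linear scaleS scaleV h by fact
    \<comment> \<open>Only \<open>h 0\<close> contributes the value of \<open>g\<close> at 1; the 0
      is a default.\<close>
    obtain h' where h': "Vector_Spaces.linear scaleS scaleV h'" "h' 1 = 0"
      "\<And>b X. h' (\<iota> b * X) = \<rho> b (h X) - h (der b X)"
      by (rule lift_step[OF V, of "\<lambda>b X. \<rho> b (h X) - h (der b X)" 0])
        (use sym in \<open>auto simp: \<rho>1 \<rho>2 der_add der_scale der_add_left der_scale_left h.add h.scale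
          V.scale_right_diff_distrib\<close>)
    interpret h': Vector_Spaces.linear scaleS scaleV h' by fact
    have "\<rho> c (h' (\<iota> d * X)) - h' (der c (\<iota> d * X)) = \<rho> d (h' (\<iota> c * X)) - h' (der d (\<iota> c * X))"
      for c d X
    proof -
      \<comment> \<open>Of the three groups of terms, the first is symmetric in \<open>c\<close> and
        \<open>d\<close> by \<open>comm\<close>, the second by \<open>der_commute\<close>, the third
        visibly.\<close>
      have *: "\<rho> c (h' (\<iota> d * X)) - h' (der c (\<iota> d * X)) =
        (\<rho> c (\<rho> d (h X)) - \<rho> (d \<lhd> c) (h X)) + (h (der (d \<lhd> c) X) + h (der d (der c X)))
        - (\<rho> c (h (der d X)) + \<rho> d (h (der c X)))" for c d
        by (simp only: h' der_mult der_iota h'.add \<rho>_diff) (simp add: algebra_simps)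
      have "\<rho> c (\<rho> d (h X)) - \<rho> (d \<lhd> c) (h X) = \<rho> d (\<rho> c (h X)) - \<rho> (c \<lhd> d) (h X)"
        using comm[of c d "h X"] by (simp add: algebra_simps)
      moreover have "h (der (d \<lhd> c) X) + h (der d (der c X)) = h (der (c \<lhd> d) X) + h (der c (der d X))"
        using der_commute[of c d X] by (metis h.add add.commute)
      ultimately show ?thesis unfolding * by (simp add: add.commute)
    qed
    then show "\<exists>h'. P (Suc n) h' \<and> (\<forall>b X. h' (\<iota> b * X) = \<rho> b (h X) - h (der b X))"
      using h' unfolding P_def by blast
  qed
  then obtain h where "\<And>n. P n (h n)"
    and h_Suc: "\<And>n b X. h (Suc n) (\<iota> b * X) = \<rho> b (h n X) - h n (der b X)" by blast
  then have h: "\<And>n. Vector_Spaces.linear scaleS scaleV (h n)" and "h 0 1 = v"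
    unfolding P_def by blast+
  have h_lin: "h n (X + Y) = h n X + h n Y" "h n (scaleS c X) = scaleV c (h n X)" for n X Y c
    using h[of n] by (simp_all add: linear_S_iff)
  \<comment> \<open>The maps are glued: each \<open>h n\<close> is used in degree \<open>n\<close>
    only.\<close>
  have "multilinear scaleV (\<lambda>M. h (size M) (monomial M))"
    by (simp add: multilinear_def iota_add iota_scale distrib_right h_lin flip: scaleS_mult)
  then obtain g where g: "Vector_Spaces.linear scaleS scaleV g"
    "\<And>M. g (monomial M) = h (size M) (monomial M)"
    using sym_lift[OF V] by blast
  interpret g: Vector_Spaces.linear scaleS scaleV g by fact
  have "(\<lambda>X. g (T b X)) = (\<lambda>X. \<rho> b (g X))" for b
  proof (rule linear_eqI[where scaleV = scaleV])
    fix M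
    have "g (der b (monomial M)) = h (size M) (der b (monomial M))"
      by (rule linear_monomial_span_eq[OF g(1) h _ der_monomial]) (simp add: g(2))
    then show "g (T b (monomial M)) = \<rho> b (g (monomial M))"
      using g(2)[of "add_mset b M"] by (simp add: T_def g.add g(2) h_Suc)
  qed (simp_all add: linear_S_iff V T_add T_scale g.add g.scale \<rho>2)
  then have "g (T b X) = \<rho> b (g X)" for b X by metis
  moreover have "g 1 = v" using g(2)[of "{#}"] \<open>h 0 1 = v\<close> by simp
  ultimately show thesis using g(1) that by blast
qed

section \<open>The action on L and the enveloping product as module structures\<close>

definition act :: "'l \<Rightarrow> 's \<Rightarrow> 'l" where
  "act a = (SOME g. Vector_Spaces.linear scaleS scale g \<and> g 1 = a \<and> (\<forall>b X. g (T b X) = g X \<lhd> b))"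

lemma act_linear: "Vector_Spaces.linear scaleS scale (act a)" (is ?lin)
  and act_one [simp]: "act a 1 = a" (is ?one)
  and act_T: "act a (T b X) = act a X \<lhd> b" (is ?T)
proof -
  obtain g where "Vector_Spaces.linear scaleS scale g" "g 1 = a" "\<And>b X. g (T b X) = g X \<lhd> b"
  proof (rule module_lift[OF L.vector_space_axioms, of "\<lambda>b x. x \<lhd> b" a])
    show "x \<lhd> d \<lhd> c + x \<lhd> (c \<lhd> d) = x \<lhd> c \<lhd> d + x \<lhd> (d \<lhd> c)" for c d x
      using prelie[of x c d] by (simp add: algebra_simps)
  qed (use pl_add_left pl_scale_left pl_add_right pl_scale_right in auto)
  then have "\<exists>g. Vector_Spaces.linear scaleS scale g \<and> g 1 = a \<and> (\<forall>b X. g (T b X) = g X \<lhd> b)"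
    by blast
  from someI_ex[OF this] show ?lin ?one ?T unfolding act_def by blast+
qed

definition mul :: "'s \<Rightarrow> 's \<Rightarrow> 's" where
  "mul A = (SOME g. Vector_Spaces.linear scaleS scaleS g \<and> g 1 = A \<and> (\<forall>b X. g (T b X) = T b (g X)))"

lemma mul_linear: "Vector_Spaces.linear scaleS scaleS (mul A)" (is ?lin)
  and mul_one_right [simp]: "mul A 1 = A" (is ?one)
  and mul_T: "mul A (T b X) = T b (mul A X)" (is ?T)
proof -
  obtain g where "Vector_Spaces.linear scaleS scaleS g" "g 1 = A" "\<And>b X. g (T b X) = T b (g X)"
    by (rule module_lift[OF S.vector_space_axioms, of T A])
      (use T_add T_scale T_add_left T_scale_left T_commute in auto)
  then have "\<exists>g. Vector_Spaces.linear scaleS scaleS g \<and> g 1 = A \<and> (\<forall>b X. g (T b X) = T b (g X))"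
    by blast
  from someI_ex[OF this] show ?lin ?one ?T unfolding mul_def by blast+
qed

lemma act_add: "act a (X + Y) = act a X + act a Y"
  and act_scale: "act a (scaleS c X) = scale c (act a X)"
  using act_linear by (simp_all add: linear_S_iff)

lemma mul_add_right: "mul A (X + Y) = mul A X + mul A Y"
  and mul_scale_right: "mul A (scaleS c X) = scaleS c (mul A X)"
  using mul_linear by (simp_all add: linear_S_iff)

lemma mul_add_left: "mul (A + B) X = mul A X + mul B X"
  by (induction X rule: T_induct)
    (simp_all add: mul_add_right mul_scale_right mul_T T_add S.scale_right_distrib algebra_simps)

lemma mul_scale_left: "mul (scaleS c A) X = scaleS c (mul A X)"
  by (induction X rule: T_induct)
    (simp_all add: mul_add_right mul_scale_right mul_T T_scale S.scale_right_distrib mult.commute)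

lemma mul_one_left [simp]: "mul 1 X = X"
  by (induction X rule: T_induct) (simp_all add: mul_add_right mul_scale_right mul_T)

text \<open>Writing \<open>X * \<iota> c\<close> as \<open>T c X - der c X\<close> turns the
  recursion of \<open>is_action\<close> into compatibility with \<open>T\<close>, and this
  determines the map by \<open>T_induct\<close>.\<close>

lemma action_eq: "action a = act a"
  unfolding action_def
proof (rule the_equality)
  have "act a (\<iota> b) = a \<lhd> b" for b
    using act_T[of a b 1] by simp
  moreover have "act a ((\<Prod>j=1..m. \<iota> (b j)) * \<iota> c) = act a (\<Prod>j=1..m. \<iota> (b j)) \<lhd> c
      - (\<Sum>i=1..m. act a (\<Prod>j=1..m. \<iota> ((b(i := b i \<lhd> c)) j)))" for m :: nat and b c
  proof -
    interpret act: Vector_Spaces.linear scaleS scale "act a" by (rule act_linear)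
    have "(\<Prod>j=1..m. \<iota> (b j)) * \<iota> c = T c (\<Prod>j=1..m. \<iota> (b j)) - der c (\<Prod>j=1..m. \<iota> (b j))"
      by (simp add: T_def)
    then show ?thesis by (simp add: act.diff act_T der_prod act.sum)
  qed
  ultimately show "is_action a (act a)"
    by (simp add: is_action_def act_linear)
next
  fix g assume "is_action a g"
  then have lin: "Vector_Spaces.linear scaleS scale g" and "g 1 = a"
    and step: "g ((\<Prod>j=1..m. \<iota> (b j)) * \<iota> c) = g (\<Prod>j=1..m. \<iota> (b j)) \<lhd> c
        - (\<Sum>i=1..m. g (\<Prod>j=1..m. \<iota> ((b(i := b i \<lhd> c)) j)))" for m :: nat and b c
    unfolding is_action_def by blast+
  interpret g: Vector_Spaces.linear scaleS scale g by fact
  have "(\<lambda>X. g (T c X)) = (\<lambda>X. g X \<lhd> c)" for c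
  proof (rule linear_eqI[where scaleV = scale])
    fix M
    obtain b where b: "monomial M = (\<Prod>j=1..size M. \<iota> (b j))" by (rule monomial_as_prod)
    show "g (T c (monomial M)) = g (monomial M) \<lhd> c"
      unfolding b T_def using step[of b "size M" c]
      by (simp add: g.add der_prod g.sum mult.commute)
  qed (simp_all add: linear_S_iff L.vector_space_axioms T_add T_scale g.add g.scale pl_add_left pl_scale_left)
  then have T: "g (T c X) = g X \<lhd> c" for c X by metis
  show "g = act a"
  proof
    show "g X = act a X" for X
      by (induction X rule: T_induct)
        (simp_all add: \<open>g 1 = a\<close> g.add g.scale act_add act_scale T act_T)
  qed
qed

end

context symmetric_algebra
begin

subsection \<open>The unshuffling coproduct\<close>

definition bilinear :: "('s \<Rightarrow> 's \<Rightarrow> 's) \<Rightarrow> bool" where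
  "bilinear \<beta> \<longleftrightarrow>
     (\<forall>Y. Vector_Spaces.linear scaleS scaleS (\<lambda>X. \<beta> X Y)) \<and>
     (\<forall>X. Vector_Spaces.linear scaleS scaleS (\<beta> X))"

lemma bilinear_iff:
  "bilinear \<beta> \<longleftrightarrow>
     (\<forall>X X' Y. \<beta> (X + X') Y = \<beta> X Y + \<beta> X' Y) \<and> (\<forall>c X Y. \<beta> (scaleS c X) Y = scaleS c (\<beta> X Y)) \<and>
     (\<forall>X Y Y'. \<beta> X (Y + Y') = \<beta> X Y + \<beta> X Y') \<and> (\<forall>c X Y. \<beta> X (scaleS c Y) = scaleS c (\<beta> X Y))"
  by (auto simp: bilinear_def linear_S_iff S.vector_space_axioms)

lemma bilinear_zero: "bilinear \<beta> \<Longrightarrow> \<beta> 0 Y = 0 \<and> \<beta> X 0 = 0"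
  by (metis bilinear_iff S.scale_zero_left)

lemma bilinear_compose:
  assumes "bilinear \<beta>" "Vector_Spaces.linear scaleS scaleS f" "Vector_Spaces.linear scaleS scaleS g"
  shows "bilinear (\<lambda>X Y. \<beta> (f X) (g Y))"
  using assms by (simp add: bilinear_iff linear_S_iff)

lemma bilinear_compose_left:
  "bilinear \<beta> \<Longrightarrow> Vector_Spaces.linear scaleS scaleS f \<Longrightarrow> bilinear (\<lambda>X Y. \<beta> (f X) Y)"
  using bilinear_compose[OF _ _ S.linear_ident] .

lemma bilinear_compose_right:
  "bilinear \<beta> \<Longrightarrow> Vector_Spaces.linear scaleS scaleS f \<Longrightarrow> bilinear (\<lambda>X Y. \<beta> X (f Y))"
  using bilinear_compose[OF _ S.linear_ident] .

lemma linear_times: "Vector_Spaces.linear scaleS scaleS ((*) A)"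
  by (simp add: linear_S_iff S.vector_space_axioms distrib_left scaleS_mult_right)

lemmas bilinear_times =
  bilinear_compose_left[OF _ linear_times] bilinear_compose_right[OF _ linear_times]

text \<open>
  \<open>cop \<beta>\<close> is the bilinear map \<open>\<beta>\<close> applied to the unshuffling coproduct, which needs no tensor
  products: multiplying the argument by \<open>\<iota> x\<close> multiplies either the left or the right factor.
\<close>

definition cop_step :: "'l \<Rightarrow> (('s \<Rightarrow> 's \<Rightarrow> 's) \<Rightarrow> 's) \<Rightarrow> ('s \<Rightarrow> 's \<Rightarrow> 's) \<Rightarrow> 's" where
  "cop_step x \<Phi> \<beta> = \<Phi> (\<lambda>X Y. \<beta> (\<iota> x * X) Y) + \<Phi> (\<lambda>X Y. \<beta> X (\<iota> x * Y))"

text \<open>The fold accumulates functionals of bilinear maps, so that each step may alter the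
  \<open>\<beta>\<close> passed to the remaining ones.\<close>

definition cop_mset :: "('s \<Rightarrow> 's \<Rightarrow> 's) \<Rightarrow> 'l multiset \<Rightarrow> 's" where
  "cop_mset \<beta> M = fold_mset cop_step (\<lambda>\<beta>. \<beta> 1 1) M \<beta>"

definition cop :: "('s \<Rightarrow> 's \<Rightarrow> 's) \<Rightarrow> 's \<Rightarrow> 's" where
  "cop \<beta> = (SOME g. Vector_Spaces.linear scaleS scaleS g \<and> (\<forall>M. g (monomial M) = cop_mset \<beta> M))"

lemma cop_mset_empty: "cop_mset \<beta> {#} = \<beta> 1 1"
  by (simp add: cop_mset_def)

lemma cop_mset_add_mset:
  "cop_mset \<beta> (add_mset x M) =
    cop_mset (\<lambda>X Y. \<beta> (\<iota> x * X) Y) M + cop_mset (\<lambda>X Y. \<beta> X (\<iota> x * Y)) M"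
proof -
  interpret comp_fun_commute cop_step
    by standard (auto simp: fun_eq_iff cop_step_def mult.left_commute add_ac)
  show ?thesis unfolding cop_mset_def by (simp add: cop_step_def)
qed

lemma cop_mset_add: "cop_mset (\<lambda>X Y. \<beta> X Y + \<gamma> X Y) M = cop_mset \<beta> M + cop_mset \<gamma> M"
  by (induction M arbitrary: \<beta> \<gamma>) (simp_all add: cop_mset_empty cop_mset_add_mset)

lemma cop_mset_scale: "cop_mset (\<lambda>X Y. scaleS c (\<beta> X Y)) M = scaleS c (cop_mset \<beta> M)"
  by (induction M arbitrary: \<beta>)
    (simp_all add: cop_mset_empty cop_mset_add_mset S.scale_right_distrib)

context
  fixes \<beta> :: "'s \<Rightarrow> 's \<Rightarrow> 's"
  assumes bil: "bilinear \<beta>"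
begin

lemma cop_linear: "Vector_Spaces.linear scaleS scaleS (cop \<beta>)"
  and cop_monomial: "cop \<beta> (monomial M) = cop_mset \<beta> M"
proof -
  have "multilinear scaleS (cop_mset \<beta>)"
    using bil by (simp add: multilinear_def cop_mset_add_mset iota_add iota_scale distrib_right
        bilinear_iff cop_mset_add cop_mset_scale S.scale_right_distrib flip: scaleS_mult)
  then have "\<exists>g. Vector_Spaces.linear scaleS scaleS g \<and> (\<forall>M. g (monomial M) = cop_mset \<beta> M)"
    using sym_lift[OF S.vector_space_axioms] by blast
  from someI_ex[OF this]
  show "Vector_Spaces.linear scaleS scaleS (cop \<beta>)" "cop \<beta> (monomial M) = cop_mset \<beta> M"
    unfolding cop_def by blast+
qed

lemma cop_one [simp]: "cop \<beta> 1 = \<beta> 1 1"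
  using cop_monomial[of "{#}"] by (simp add: cop_mset_empty)

lemma cop_add_arg: "cop \<beta> (X + Y) = cop \<beta> X + cop \<beta> Y"
  and cop_scale_arg: "cop \<beta> (scaleS c X) = scaleS c (cop \<beta> X)"
  using cop_linear by (simp_all add: linear_S_iff)

end

lemma cop_mult:
  assumes "bilinear \<beta>"
  shows "cop \<beta> (\<iota> x * B) = cop (\<lambda>X Y. \<beta> (\<iota> x * X) Y) B + cop (\<lambda>X Y. \<beta> X (\<iota> x * Y)) B"
proof -
  note b = assms bilinear_times[OF assms]
  have "(\<lambda>B. cop \<beta> (\<iota> x * B)) =
    (\<lambda>B. cop (\<lambda>X Y. \<beta> (\<iota> x * X) Y) B + cop (\<lambda>X Y. \<beta> X (\<iota> x * Y)) B)"
  proof (rule linear_eqI[where scaleV = scaleS])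
    show "cop \<beta> (\<iota> x * monomial M) =
      cop (\<lambda>X Y. \<beta> (\<iota> x * X) Y) (monomial M) + cop (\<lambda>X Y. \<beta> X (\<iota> x * Y)) (monomial M)" for M
      using cop_monomial[OF b(1), of "add_mset x M"] by (simp add: cop_monomial b cop_mset_add_mset)
  qed (simp_all add: linear_S_iff S.vector_space_axioms cop_add_arg cop_scale_arg b distrib_left
      scaleS_mult_right S.scale_right_distrib)
  then show ?thesis by metis
qed

lemma bilinear_add: "bilinear \<beta> \<Longrightarrow> bilinear \<gamma> \<Longrightarrow> bilinear (\<lambda>X Y. \<beta> X Y + \<gamma> X Y)"
  by (simp add: bilinear_iff S.scale_right_distrib add_ac)

lemma bilinear_scale: "bilinear \<beta> \<Longrightarrow> bilinear (\<lambda>X Y. scaleS c (\<beta> X Y))"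
  by (simp add: bilinear_iff S.scale_right_distrib mult.commute)

lemma bilinear_0: "bilinear (\<lambda>X Y. 0)"
  by (simp add: bilinear_iff)

lemma bilinear_sum:
  "(\<And>i. i \<in> A \<Longrightarrow> bilinear (\<beta> i)) \<Longrightarrow> bilinear (\<lambda>X Y. \<Sum>i\<in>A. \<beta> i X Y)"
  by (induction A rule: infinite_finite_induct) (simp_all add: bilinear_0 bilinear_add)

lemma cop_linear_comp:
  assumes "bilinear \<beta>" and f: "Vector_Spaces.linear scaleS scaleS f"
  shows "cop (\<lambda>X Y. f (\<beta> X Y)) B = f (cop \<beta> B)"
  using assms(1)
proof (induction B arbitrary: \<beta> rule: sym_induct)
  case one
  moreover from this have "bilinear (\<lambda>X Y. f (\<beta> X Y))" using f by (simp add: bilinear_iff linear_S_iff)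
  ultimately show ?case by simp
next
  case (add X Y)
  moreover from this have "bilinear (\<lambda>X Y. f (\<beta> X Y))" using f by (simp add: bilinear_iff linear_S_iff)
  ultimately show ?case using f by (simp add: cop_add_arg linear_S_iff)
next
  case (scale c X)
  moreover from this have "bilinear (\<lambda>X Y. f (\<beta> X Y))" using f by (simp add: bilinear_iff linear_S_iff)
  ultimately show ?case using f by (simp add: cop_scale_arg linear_S_iff)
next
  case (mult x X)
  moreover from this have "bilinear (\<lambda>X Y. f (\<beta> X Y))" using f by (simp add: bilinear_iff linear_S_iff)
  ultimately show ?case using f bilinear_times[OF mult.prems] by (simp add: cop_mult linear_S_iff)
qed

lemma cop_add:
  assumes "bilinear \<beta>" "bilinear \<gamma>"
  shows "cop (\<lambda>X Y. \<beta> X Y + \<gamma> X Y) B = cop \<beta> B + cop \<gamma> B"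
proof -
  note b = assms bilinear_add[OF assms]
  have "cop (\<lambda>X Y. \<beta> X Y + \<gamma> X Y) = (\<lambda>B. cop \<beta> B + cop \<gamma> B)"
    by (rule linear_eqI[where scaleV = scaleS])
      (simp_all add: linear_S_iff S.vector_space_axioms cop_add_arg cop_scale_arg cop_monomial b
        cop_mset_add S.scale_right_distrib)
  then show ?thesis by metis
qed

lemma cop_scale: "bilinear \<beta> \<Longrightarrow> cop (\<lambda>X Y. scaleS c (\<beta> X Y)) B = scaleS c (cop \<beta> B)"
  by (rule cop_linear_comp) simp_all

lemma cop_zero: "cop (\<lambda>X Y. 0) B = 0"
  using cop_scale[OF bilinear_0, of 0] by simp

lemma cop_sum:
  assumes "\<And>i. i \<in> A \<Longrightarrow> bilinear (\<beta> i)"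
  shows "cop (\<lambda>X Y. \<Sum>i\<in>A. \<beta> i X Y) B = (\<Sum>i\<in>A. cop (\<beta> i) B)"
  using assms
  by (induction A rule: infinite_finite_induct) (simp_all add: cop_zero cop_add bilinear_sum)

text \<open>Each factor goes to the left or to the right, and \<open>I\<close> collects those on the
  left. In the induction, the subsets of \<open>insert a A\<close> with and without \<open>a\<close>
  correspond to the two summands of \<open>cop_mult\<close>.\<close>

lemma cop_prod:
  assumes "finite A" "bilinear \<beta>"
  shows "cop \<beta> (\<Prod>j\<in>A. \<iota> (l j)) = (\<Sum>I\<in>Pow A. \<beta> (\<Prod>j\<in>I. \<iota> (l j)) (\<Prod>j\<in>A - I. \<iota> (l j)))"
  using assms
proof (induction A arbitrary: \<beta> rule: finite_induct)
  case (insert a A)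
  let ?p = "\<lambda>I. \<Prod>j\<in>I. \<iota> (l j)"
  have fin: "finite I" if "I \<subseteq> A" for I using that insert.hyps(1) finite_subset by blast
  have inj: "inj_on (insert a) (Pow A)" using insert.hyps(2) by (auto intro!: inj_onI)
  have 1: "(\<Sum>I\<in>Pow A. \<beta> (?p I) (\<iota> (l a) * ?p (A - I))) = (\<Sum>I\<in>Pow A. \<beta> (?p I) (?p (insert a A - I)))"
  proof (rule sum.cong)
    fix I assume "I \<in> Pow A"
    then have "insert a A - I = insert a (A - I)" using insert.hyps(2) by auto
    then show "\<beta> (?p I) (\<iota> (l a) * ?p (A - I)) = \<beta> (?p I) (?p (insert a A - I))"
      using insert.hyps by simp
  qed simp
  have 2: "(\<Sum>I\<in>Pow A. \<beta> (\<iota> (l a) * ?p I) (?p (A - I))) =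
    (\<Sum>I\<in>insert a ` Pow A. \<beta> (?p I) (?p (insert a A - I)))"
    unfolding sum.reindex[OF inj]
  proof (rule sum.cong)
    fix I assume "I \<in> Pow A"
    moreover from this have "insert a A - insert a I = A - I" using insert.hyps(2) by auto
    moreover have "a \<notin> I" using \<open>I \<in> Pow A\<close> insert.hyps(2) by auto
    ultimately show "\<beta> (\<iota> (l a) * ?p I) (?p (A - I)) =
      ((\<lambda>I. \<beta> (?p I) (?p (insert a A - I))) \<circ> insert a) I"
      using fin by simp
  qed simp
  have "cop \<beta> (?p (insert a A)) = (\<Sum>I\<in>Pow A. \<beta> (\<iota> (l a) * ?p I) (?p (A - I)))
      + (\<Sum>I\<in>Pow A. \<beta> (?p I) (\<iota> (l a) * ?p (A - I)))"
    using insert.hyps insert.IH[OF bilinear_times(1)[OF insert.prems]]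
      insert.IH[OF bilinear_times(2)[OF insert.prems]]
    by (simp add: cop_mult insert.prems)
  also have "\<dots> = (\<Sum>I\<in>Pow A \<union> insert a ` Pow A. \<beta> (?p I) (?p (insert a A - I)))"
    unfolding 1 2 using insert.hyps by (subst sum.union_disjoint) (auto simp: add.commute)
  finally show ?case by (simp add: Pow_insert)
qed simp

end

section \<open>Coderivations and the explicit formula for the product\<close>

context prelie_symmetric
begin

text \<open>A derivation mapping L to L is a coderivation, because elements of L are primitive for
  the unshuffling coproduct.\<close>

lemma cop_der:
  assumes "bilinear \<beta>"
  shows "cop \<beta> (der b B) = cop (\<lambda>X Y. \<beta> (der b X) Y) B + cop (\<lambda>X Y. \<beta> X (der b Y)) B"
  using assms
proof (induction B arbitrary: \<beta> rule: sym_induct)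
  case one
  note b = one bilinear_compose_left[OF one der] bilinear_compose_right[OF one der]
  have "cop \<beta> 0 = 0" using cop_scale_arg[OF one, of 0 0] by simp
  then show ?case using bilinear_zero[OF one] by (simp add: b)
next
  case (add B C)
  note b = add.prems bilinear_compose_left[OF add.prems der] bilinear_compose_right[OF add.prems der]
  show ?case using add by (simp add: b cop_add_arg der_add)
next
  case (scale c B)
  note b = scale.prems bilinear_compose_left[OF scale.prems der]
    bilinear_compose_right[OF scale.prems der]
  show ?case using scale by (simp add: b cop_scale_arg der_scale S.scale_right_distrib)
next
  case (mult x B)
  note \<beta> = mult.prems
  note b = bilinear_compose_left[OF \<beta>] bilinear_compose_right[OF \<beta>]
  note b2 = bilinear_times[OF \<beta>] b[OF der] bilinear_times[OF b(1)[OF der]]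
    bilinear_times[OF b(2)[OF der]] bilinear_times[OF \<beta>, of "\<iota> (x \<lhd> b)"]
    bilinear_compose_left[OF bilinear_times(1)[OF \<beta>] der]
    bilinear_compose_left[OF bilinear_times(2)[OF \<beta>] der]
    bilinear_compose_right[OF bilinear_times(1)[OF \<beta>] der]
    bilinear_compose_right[OF bilinear_times(2)[OF \<beta>] der]
  have add: "\<beta> (X + Y) Z = \<beta> X Z + \<beta> Y Z" "\<beta> Z (X + Y) = \<beta> Z X + \<beta> Z Y" for X Y Z
    using \<beta> by (simp_all add: bilinear_iff)
  show ?case
    using mult.IH[OF b2(1)] mult.IH[OF b2(2)]
    by (simp add: der_mult cop_add_arg \<beta> cop_mult b2 add cop_add)
qed

text \<open>Multiplication by a primitive element and \<open>der b\<close> are both coderivations,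
  hence so is their sum. This is the compatibility of the coproduct with right multiplication by
  elements of L in the enveloping algebra.\<close>

lemma cop_T:
  assumes "bilinear \<beta>"
  shows "cop \<beta> (T b B) = cop (\<lambda>X Y. \<beta> (T b X) Y) B + cop (\<lambda>X Y. \<beta> X (T b Y)) B"
proof -
  note b = assms bilinear_compose_left[OF assms der] bilinear_compose_right[OF assms der]
    bilinear_times[OF assms]
  have add: "\<beta> (X + Y) Z = \<beta> X Z + \<beta> Y Z" "\<beta> Z (X + Y) = \<beta> Z X + \<beta> Z Y" for X Y Z
    using assms by (simp_all add: bilinear_iff)
  show ?thesis
    by (simp add: T_def cop_add_arg cop_mult cop_der b add cop_add)
qed

lemma bilinear_mul: "bilinear mul"
  by (simp add: bilinear_iff mul_add_left mul_add_right mul_scale_left mul_scale_right)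

text \<open>The last factor absorbs one part of the coproduct of \<open>B\<close>, the rest of the
  word the other part. Both sides commute with \<open>T b\<close>: on the right by
  \<open>cop_T\<close> and a product rule for \<open>T b\<close> in which only one of the two
  factors is multiplied by \<open>\<iota> b\<close>.\<close>

lemma mul_mult_iota:
  "mul (A * \<iota> a) B = cop (\<lambda>X Y. mul A X * \<iota> (act a Y)) B"
proof (induction B rule: T_induct)
  have \<beta>: "bilinear (\<lambda>X Y. mul A X * \<iota> (act a Y))"
    by (simp add: bilinear_iff mul_add_right mul_scale_right act_add act_scale iota_add iota_scale
        algebra_simps scaleS_mult_right flip: scaleS_mult)
  {
    case one then show ?case using \<beta> by simp
  next
    case (add X Y) then show ?case using \<beta> by (simp add: mul_add_right cop_add_arg)
  next
    case (scale c X) then show ?case using \<beta> by (simp add: mul_scale_right cop_scale_arg)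
  next
    case (T b B)
    have "T b (mul A X * \<iota> (act a Y)) =
      mul A (T b X) * \<iota> (act a Y) + mul A X * \<iota> (act a (T b Y))" for X Y
      by (simp add: mul_T act_T) (simp add: T_def der_mult algebra_simps)
    then have "T b (cop (\<lambda>X Y. mul A X * \<iota> (act a Y)) B) = cop (\<lambda>X Y. mul A X * \<iota> (act a Y)) (T b B)"
      using bilinear_compose_left[OF \<beta> T_linear] bilinear_compose_right[OF \<beta> T_linear]
      by (simp add: cop_T \<beta> cop_add flip: cop_linear_comp[OF \<beta> T_linear])
    then show ?case by (simp add: mul_T T)
  }
qed

text \<open>Iterates \<open>mul_mult_iota\<close>: the factors absorbed by \<open>a (Suc l)\<close>
  are those with \<open>f j = Suc l\<close>, and the others form the index set for the induction
  hypothesis, which is why \<open>J\<close> is an arbitrary finite set.\<close>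

lemma mul_prod:
  fixes l :: nat
  assumes "finite J"
  shows "mul (\<Prod>i=1..l. \<iota> (a i)) (\<Prod>j\<in>J. \<iota> (b j)) =
    (\<Sum>f \<in> J \<rightarrow>\<^sub>E {0..l}. (\<Prod>j \<in> {j \<in> J. f j = 0}. \<iota> (b j)) *
      (\<Prod>i=1..l. \<iota> (act (a i) (\<Prod>j \<in> {j \<in> J. f j = i}. \<iota> (b j)))))"
  using assms
proof (induction l arbitrary: J)
  case 0
  have "J \<rightarrow>\<^sub>E {0..0} = {\<lambda>j\<in>J. 0::nat}"
    by (auto simp: PiE_def extensional_def fun_eq_iff)
  moreover have "{j \<in> J. (\<lambda>j\<in>J. 0::nat) j = 0} = J" by auto
  ultimately show ?case by simp
next
  case (Suc l)
  define t where "t I f = (\<Prod>j \<in> {j \<in> I. f j = 0}. \<iota> (b j)) *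
      (\<Prod>i=1..l. \<iota> (act (a i) (\<Prod>j \<in> {j \<in> I. f j = i}. \<iota> (b j))))" for I f
  define r where "r I = \<iota> (act (a (Suc l)) (\<Prod>j\<in>J - I. \<iota> (b j)))" for I
  let ?A = "\<Prod>i=1..l. \<iota> (a i)"
  have \<beta>: "bilinear (\<lambda>X Y. mul ?A X * \<iota> (act (a (Suc l)) Y))"
    by (simp add: bilinear_iff mul_add_right mul_scale_right act_add act_scale iota_add iota_scale
        algebra_simps scaleS_mult_right flip: scaleS_mult)
  have "mul (\<Prod>i=1..Suc l. \<iota> (a i)) (\<Prod>j\<in>J. \<iota> (b j)) =
    (\<Sum>I\<in>Pow J. mul ?A (\<Prod>j\<in>I. \<iota> (b j)) * r I)"
    using Suc.prems \<beta> by (simp add: mul_mult_iota cop_prod r_def)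
  also have "\<dots> = (\<Sum>I\<in>Pow J. \<Sum>f\<in>I \<rightarrow>\<^sub>E {0..l}. t I f * r I)"
  proof (rule sum.cong)
    fix I assume "I \<in> Pow J"
    then have "finite I" using Suc.prems finite_subset by blast
    from Suc.IH[OF this] show "mul ?A (\<Prod>j\<in>I. \<iota> (b j)) * r I = (\<Sum>f\<in>I \<rightarrow>\<^sub>E {0..l}. t I f * r I)"
      by (simp add: t_def sum_distrib_right)
  qed simp
  also have "\<dots> = (\<Sum>(I, f)\<in>(SIGMA I:Pow J. I \<rightarrow>\<^sub>E {0..l}). t I f * r I)"
    using Suc.prems by (subst sum.Sigma) (auto intro!: finite_PiE finite_subset[of _ J])
  \<comment> \<open>A pair \<open>(I, f)\<close> corresponds to the extension of \<open>f\<close> by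
    the value \<open>Suc l\<close> on \<open>J - I\<close>. Since \<open>f\<close> is bounded by
    \<open>l\<close>, the set \<open>I\<close> can be recovered.\<close>
  also have "\<dots> = (\<Sum>g\<in>J \<rightarrow>\<^sub>E {0..Suc l}. t {j \<in> J. g j \<le> l} g * r {j \<in> J. g j \<le> l})"
  proof (rule sum.reindex_bij_witness
      [where i = "\<lambda>g. ({j \<in> J. g j \<le> l}, restrict g {j \<in> J. g j \<le> l})"
        and j = "\<lambda>(I, f). \<lambda>j\<in>J. if j \<in> I then f j else Suc l"])
    fix p assume "p \<in> (SIGMA I:Pow J. I \<rightarrow>\<^sub>E {0..l})"
    then obtain I f where p: "p = (I, f)" and I: "I \<subseteq> J" and f: "f \<in> I \<rightarrow>\<^sub>E {0..l}" by auto
    let ?g = "\<lambda>j\<in>J. if j \<in> I then f j else Suc l"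
    have f_le: "f j \<le> l" if "j \<in> I" for j using f that by auto
    have set: "{j \<in> J. ?g j \<le> l} = I" using I f_le by auto
    moreover have "restrict ?g I = f"
      using I f by (auto simp: fun_eq_iff PiE_def extensional_def restrict_def)
    ultimately show "(case p of (I, f) \<Rightarrow> \<lambda>j\<in>J. if j \<in> I then f j else Suc l) \<in> J \<rightarrow>\<^sub>E {0..Suc l}"
      and "({j \<in> J. (case p of (I, f) \<Rightarrow> \<lambda>j\<in>J. if j \<in> I then f j else Suc l) j \<le> l},
        restrict (case p of (I, f) \<Rightarrow> \<lambda>j\<in>J. if j \<in> I then f j else Suc l)
          {j \<in> J. (case p of (I, f) \<Rightarrow> \<lambda>j\<in>J. if j \<in> I then f j else Suc l) j \<le> l}) = p"
      using f_le le_SucI[OF f_le] p by auto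
    have "{j \<in> I. ?g j = i} = {j \<in> I. f j = i}" for i using I by auto
    then have "t I ?g = t I f" by (simp add: t_def)
    then show "t {j \<in> J. (case p of (I, f) \<Rightarrow> \<lambda>j\<in>J. if j \<in> I then f j else Suc l) j \<le> l}
        (case p of (I, f) \<Rightarrow> \<lambda>j\<in>J. if j \<in> I then f j else Suc l) *
      r {j \<in> J. (case p of (I, f) \<Rightarrow> \<lambda>j\<in>J. if j \<in> I then f j else Suc l) j \<le> l} =
      (case p of (I, f) \<Rightarrow> t I f * r I)"
      using set p by simp
  next
    fix g assume g: "g \<in> J \<rightarrow>\<^sub>E {0..Suc l}"
    then have "g j = Suc l" if "j \<in> J" "\<not> g j \<le> l" for j using that by force
    with g show "(case ({j \<in> J. g j \<le> l}, restrict g {j \<in> J. g j \<le> l}) of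
        (I, f) \<Rightarrow> \<lambda>j\<in>J. if j \<in> I then f j else Suc l) = g"
      by (auto simp: fun_eq_iff PiE_def extensional_def)
    show "({j \<in> J. g j \<le> l}, restrict g {j \<in> J. g j \<le> l}) \<in> (SIGMA I:Pow J. I \<rightarrow>\<^sub>E {0..l})"
      by auto
  qed
  also have "\<dots> = (\<Sum>g\<in>J \<rightarrow>\<^sub>E {0..Suc l}. (\<Prod>j \<in> {j \<in> J. g j = 0}. \<iota> (b j)) *
      (\<Prod>i=1..Suc l. \<iota> (act (a i) (\<Prod>j \<in> {j \<in> J. g j = i}. \<iota> (b j)))))"
  proof (rule sum.cong)
    fix g assume g: "g \<in> J \<rightarrow>\<^sub>E {0..Suc l}"
    have "{j \<in> {j \<in> J. g j \<le> l}. g j = i} = {j \<in> J. g j = i}" if "i \<le> l" for i using that by auto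
    moreover have "J - {j \<in> J. g j \<le> l} = {j \<in> J. g j = Suc l}" using g by force
    ultimately show "t {j \<in> J. g j \<le> l} g * r {j \<in> J. g j \<le> l} =
      (\<Prod>j \<in> {j \<in> J. g j = 0}. \<iota> (b j)) *
      (\<Prod>i=1..Suc l. \<iota> (act (a i) (\<Prod>j \<in> {j \<in> J. g j = i}. \<iota> (b j))))"
      by (simp add: t_def r_def mult.assoc)
  qed simp
  finally show ?case .
qed

lemma star_eq: "star = mul"
  unfolding star_def
proof (rule the_equality)
  show "is_star mul"
    unfolding is_star_def action_eq
    using bilinear_mul mul_prod[OF finite_atLeastAtMost] unfolding bilinear_def by blast
next
  fix m assume m: "is_star m"
  have "m (monomial M) (monomial N) = mul (monomial M) (monomial N)" for M N
  proof -
    obtain a b where "monomial M = (\<Prod>i=1..size M. \<iota> (a i))" "monomial N = (\<Prod>j=1..size N. \<iota> (b j))"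
      using monomial_as_prod[of M] monomial_as_prod[of N] by metis
    then show ?thesis
      using m unfolding is_star_def action_eq by (simp only: mul_prod[OF finite_atLeastAtMost])
  qed
  then have "m (monomial M) = mul (monomial M)" for M
    using m mul_linear by (intro linear_eqI[where scaleV = scaleS]) (auto simp: is_star_def)
  then have "(\<lambda>X. m X Y) = (\<lambda>X. mul X Y)" for Y
    using m bilinear_mul
    by (intro linear_eqI[where scaleV = scaleS]) (auto simp: is_star_def bilinear_def)
  then show "m = mul" by (metis ext)
qed

end

subsection \<open>Convolution powers and ordered partitions\<close>

lemma degree_prod_falling: "degree (\<Prod>m<j. [:- int m, 1:]) = j"
  by (subst degree_prod_sum_eq) auto

lemma signed_stirling1_eq_0: "j < i \<Longrightarrow> signed_stirling1 j i = 0"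
  unfolding signed_stirling1_def by (rule coeff_eq_0) (simp add: degree_prod_falling)

text \<open>The falling factorial evaluated at \<open>k\<close> is \<open>fact j\<close> times the
  binomial coefficient. The free upper bound \<open>N\<close> gives all \<open>j\<close> a common
  range, so that sums can later be exchanged.\<close>

lemma sum_signed_stirling1:
  assumes "j \<le> N"
  shows "(\<Sum>i\<le>N. of_nat k ^ i * (of_int (signed_stirling1 j i) / fact j)) =
    (of_nat (k choose j) :: 'a::field_char_0)"
proof -
  let ?P = "\<Prod>m<j. [:- int m, 1:]"
  have "(\<Sum>i\<le>N. signed_stirling1 j i * int k ^ i) = (\<Sum>i\<le>degree ?P. coeff ?P i * int k ^ i)"
    using assms by (intro sum.mono_neutral_cong_right)
      (auto simp: degree_prod_falling signed_stirling1_eq_0 signed_stirling1_def[symmetric])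
  also have "\<dots> = poly ?P (int k)" by (simp only: poly_altdef)
  also have "\<dots> = (\<Prod>m<j. int k - int m)" by (simp add: poly_prod)
  finally have "of_int (\<Sum>i\<le>N. signed_stirling1 j i * int k ^ i) = (of_int (\<Prod>m<j. int k - int m) :: 'a)"
    by simp
  then have "(\<Sum>i\<le>N. of_int (signed_stirling1 j i) * of_nat k ^ i) =
      (fact j * of_nat (k choose j) :: 'a)"
    by (simp add: binomial_gbinomial gbinomial_mult_fact atLeast0LessThan)
  moreover have "(\<Sum>i\<le>N. of_nat k ^ i * (of_int (signed_stirling1 j i) / fact j)) =
    (\<Sum>i\<le>N. of_int (signed_stirling1 j i) * of_nat k ^ i) / (fact j :: 'a)"
    by (simp add: sum_divide_distrib mult.commute)
  ultimately show ?thesis by simp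
qed

text \<open>The factor for \<open>m = 0\<close> is the indeterminate; without it, the linear
  coefficient becomes the constant coefficient of the remaining product.\<close>

lemma signed_stirling1_Suc_1: "signed_stirling1 (Suc j) 1 = (- 1) ^ j * fact j"
proof -
  have "signed_stirling1 (Suc j) 1 = coeff (\<Prod>m<j. [:- int (Suc m), 1:]) 0"
    unfolding signed_stirling1_def by (simp add: prod.lessThan_Suc_shift del: prod.lessThan_Suc)
  also have "\<dots> = (\<Prod>m<j. - int (Suc m))"
    by (simp add: poly_prod flip: poly_0_coeff_0)
  also have "\<dots> = (- 1) ^ j * fact j"
    by (induction j) (simp_all add: algebra_simps)
  finally show ?thesis .
qed

lemma snoc_in_ordered_partitions_iff:
  "Is @ [B] \<in> ordered_partitions A (Suc j) \<longleftrightarrow>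
    B \<noteq> {} \<and> B \<subseteq> A \<and> Is \<in> ordered_partitions (A - B) j"
proof -
  have "disjnt B (\<Union>(set Is))" if "partition_on A (insert B (set Is))" "B \<notin> set Is"
    using that by (auto simp: partition_on_def pairwise_insert disjnt_iff)
  moreover have "disjnt B (\<Union>(set Is))" if "partition_on (A - B) (set Is)"
    using that by (auto simp: partition_on_def disjnt_iff)
  moreover have "B \<notin> set Is" if "partition_on (A - B) (set Is)" "B \<noteq> {}"
    using that by (auto simp: partition_on_def)
  ultimately show ?thesis
    using partition_on_insert[of B "set Is" A] by (auto simp: ordered_partitions_def)
qed

lemma finite_ordered_partitions:
  assumes "finite A"
  shows "finite (ordered_partitions A j)"
proof (rule finite_subset)
  show "ordered_partitions A j \<subseteq> {Is. set Is \<subseteq> Pow A \<and> length Is = j}"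
    by (auto simp: ordered_partitions_def partition_on_def)
  show "finite {Is. set Is \<subseteq> Pow A \<and> length Is = j}"
    using assms by (intro finite_lists_length_eq) simp
qed

text \<open>\<open>I\<close> is the union of the first \<open>j\<close> blocks, a proper subset
  because the last block is nonempty. Splitting at the end fits the left fold in
  \<open>star_list\<close> and the recursion of \<open>Q\<close>.\<close>

lemma sum_ordered_partitions_Suc:
  assumes "finite A"
  shows "(\<Sum>Is\<in>ordered_partitions A (Suc j). f Is) =
    (\<Sum>I\<in>Pow A - {A}. \<Sum>Is\<in>ordered_partitions I j. f (Is @ [A - I]))"
proof -
  have "(\<Sum>I\<in>Pow A - {A}. \<Sum>Is\<in>ordered_partitions I j. f (Is @ [A - I])) =
    (\<Sum>(I, Is)\<in>(SIGMA I:Pow A - {A}. ordered_partitions I j). f (Is @ [A - I]))"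
    using assms by (intro sum.Sigma) (auto intro!: finite_ordered_partitions intro: finite_subset)
  also have "\<dots> = (\<Sum>Is\<in>ordered_partitions A (Suc j). f Is)"
  proof (rule sum.reindex_bij_witness[where j = "\<lambda>(I, Is). Is @ [A - I]"
        and i = "\<lambda>Is. (A - last Is, butlast Is)"])
    fix p assume "p \<in> (SIGMA I:Pow A - {A}. ordered_partitions I j)"
    then obtain I Is where "p = (I, Is)" "I \<subseteq> A" "I \<noteq> A" "Is \<in> ordered_partitions I j" by auto
    moreover from this have "A - (A - I) = I" by auto
    ultimately show "(A - last (case p of (I, Is) \<Rightarrow> Is @ [A - I]),
        butlast (case p of (I, Is) \<Rightarrow> Is @ [A - I])) = p"
      "(case p of (I, Is) \<Rightarrow> Is @ [A - I]) \<in> ordered_partitions A (Suc j)"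
      "f (case p of (I, Is) \<Rightarrow> Is @ [A - I]) = (case p of (I, Is) \<Rightarrow> f (Is @ [A - I]))"
      by (auto simp: snoc_in_ordered_partitions_iff)
  next
    fix Is assume Is: "Is \<in> ordered_partitions A (Suc j)"
    then have "length Is = Suc j" by (simp add: ordered_partitions_def)
    then obtain Js B where "Is = Js @ [B]" by (cases Is rule: rev_cases) auto
    moreover from this Is have "B \<noteq> {}" "B \<subseteq> A" "Js \<in> ordered_partitions (A - B) j"
      by (simp_all add: snoc_in_ordered_partitions_iff)
    moreover from this have "A - (A - B) = B" by auto
    ultimately show "(case (A - last Is, butlast Is) of (I, Is) \<Rightarrow> Is @ [A - I]) = Is"
      "(A - last Is, butlast Is) \<in> (SIGMA I:Pow A - {A}. ordered_partitions I j)"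
      by auto
  qed
  finally show ?thesis by simp
qed

context symmetric_algebra
begin

text \<open>Pascal's rule, for the coproduct of powers and for the expansion of \<open>psi\<close>
  in terms of \<open>Q\<close>.\<close>

lemma sum_choose_Suc:
  "(\<Sum>j\<le>Suc n. scaleS (of_nat (Suc n choose j)) (f j)) =
    (\<Sum>j\<le>n. scaleS (of_nat (n choose j)) (f (Suc j))) + (\<Sum>j\<le>n. scaleS (of_nat (n choose j)) (f j))"
proof -
  have "(\<Sum>j\<le>n. scaleS (of_nat (n choose j)) (f j)) = (\<Sum>j\<le>Suc n. scaleS (of_nat (n choose j)) (f j))"
    by (simp add: binomial_eq_0)
  also have "\<dots> = f 0 + (\<Sum>j\<le>n. scaleS (of_nat (n choose Suc j)) (f (Suc j)))"
    by (simp add: sum.atMost_Suc_shift del: sum.atMost_Suc)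
  finally show ?thesis
    by (simp add: sum.atMost_Suc_shift S.scale_left_distrib sum.distrib add_ac del: sum.atMost_Suc)
qed

text \<open>The counit followed by the unit, that is, the neutral element for convolution of
  endomorphisms.\<close>

definition eps :: "'s \<Rightarrow> 's" where
  "eps = (SOME h. Vector_Spaces.linear scaleS scaleS h \<and> h 1 = 1 \<and> (\<forall>x X. h (\<iota> x * X) = 0))"

lemma eps_linear: "Vector_Spaces.linear scaleS scaleS eps" (is ?lin)
  and eps_one [simp]: "eps 1 = 1" (is ?one)
  and eps_mult [simp]: "eps (\<iota> x * X) = 0" (is ?mult)
proof -
  obtain h :: "'s \<Rightarrow> 's" where "Vector_Spaces.linear scaleS scaleS h" "h 1 = 1" "\<And>x X. h (\<iota> x * X) = 0"
    by (rule lift_step[OF S.vector_space_axioms, of "\<lambda>_ _. 0" 1]) auto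
  then have "\<exists>h. Vector_Spaces.linear scaleS scaleS h \<and> h 1 = 1 \<and> (\<forall>x X. h (\<iota> x * X) = 0)" by blast
  from someI_ex[OF this] show ?lin ?one ?mult unfolding eps_def by blast+
qed

lemma eps_add: "eps (X + Y) = eps X + eps Y"
  and eps_scale: "eps (scaleS c X) = scaleS c (eps X)"
  using eps_linear by (simp_all add: linear_S_iff)

lemma eps_prod: "finite A \<Longrightarrow> eps (\<Prod>j\<in>A. \<iota> (l j)) = (if A = {} then 1 else 0)"
  by (induction A rule: finite_induct) simp_all

lemma cop_eps_right:
  assumes "bilinear \<beta>"
  shows "cop (\<lambda>X Y. \<beta> X (eps Y)) B = \<beta> B 1"
  using assms
proof (induction B arbitrary: \<beta> rule: sym_induct)
  case one
  then show ?case by (simp add: bilinear_compose_right eps_linear)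
next
  case (add X Y)
  then show ?case
    using add.prems[unfolded bilinear_iff] by (simp add: bilinear_compose_right eps_linear cop_add_arg)
next
  case (scale c X)
  then show ?case
    using scale.prems[unfolded bilinear_iff]
    by (simp add: bilinear_compose_right eps_linear cop_scale_arg)
next
  case (mult x X)
  then show ?case
    using bilinear_zero[OF mult.prems] mult.IH[OF bilinear_times(1)[OF mult.prems]]
    by (simp add: cop_mult bilinear_compose_right eps_linear cop_zero)
qed

end

context prelie_symmetric
begin

text \<open>Subtracting \<open>2 ^ Suc N\<close> times the value at \<open>t\<close> from the value
  at \<open>2 * t\<close> kills the top coefficient and multiplies the others by scalars that are
  nonzero in characteristic zero. For \<open>W\<close> a span this serves polarization, for
  \<open>W\<close> zero the comparison of coefficients.\<close>

lemma vandermonde: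
  fixes v :: "nat \<Rightarrow> 's"
  assumes W: "S.subspace W"
    and "\<And>t::nat. (\<Sum>j\<le>N. scaleS (of_nat t ^ j) (v j)) \<in> W" and "j \<le> N"
  shows "v j \<in> W"
  using assms(2-)
proof (induction N arbitrary: v j)
  case 0
  then show ?case using "0.prems"(1)[of 0] by simp
next
  case (Suc N)
  have less: "v j \<in> W" if "j \<le> N" for j
  proof -
    let ?v = "\<lambda>j. scaleS (2 ^ j - 2 ^ Suc N) (v j)"
    have "(\<Sum>j\<le>N. scaleS (of_nat t ^ j) (?v j)) \<in> W" for t
    proof -
      have "(\<Sum>j\<le>N. scaleS (of_nat t ^ j) (?v j)) = (\<Sum>j\<le>Suc N. scaleS (of_nat t ^ j) (?v j))"
        by simp
      also have "\<dots> = (\<Sum>j\<le>Suc N. scaleS (of_nat (2 * t) ^ j) (v j))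
          - scaleS (2 ^ Suc N) (\<Sum>j\<le>Suc N. scaleS (of_nat t ^ j) (v j))"
        unfolding S.scale_sum_right sum_subtractf[symmetric]
        by (intro sum.cong) (simp_all add: power_mult_distrib algebra_simps)
      also have "\<dots> \<in> W"
        by (intro S.subspace_diff[OF W] S.subspace_scale[OF W] Suc.prems(1))
      finally show ?thesis .
    qed
    then have "?v j \<in> W" using Suc.IH[of ?v j] that by blast
    moreover have "(2 ^ j :: 'k) \<noteq> 2 ^ Suc N"
    proof
      assume "(2 ^ j :: 'k) = 2 ^ Suc N"
      then have "(of_nat (2 ^ j) :: 'k) = of_nat (2 ^ Suc N)" by simp
      then have "(2::nat) ^ j = 2 ^ Suc N" by (metis of_nat_eq_iff)
      with that show False using power_inject_exp[of "2::nat" j "Suc N"] by simp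
    qed
    ultimately show ?thesis
      using S.subspace_scale[OF W, of "?v j" "inverse (2 ^ j - 2 ^ Suc N)"] by simp
  qed
  \<comment> \<open>At \<open>t = 1\<close> the value is the sum of all coefficients, which leaves
    the top one.\<close>
  have "(\<Sum>j\<le>Suc N. v j) - (\<Sum>j\<le>N. v j) \<in> W"
    using Suc.prems(1)[of 1] less
    by (intro S.subspace_diff[OF W]) (auto simp del: sum.atMost_Suc intro: S.subspace_sum[OF W])
  then show ?case using less Suc.prems(2) by (cases "j = Suc N") auto
qed

lemma star_list_Nil [simp]: "star_list [] = 1"
  and star_list_snoc [simp]: "star_list (Xs @ [X]) = mul (star_list Xs) X"
  by (simp_all add: star_list_def star_eq)

lemma mul_iota: "mul A (\<iota> x) = T x A"
  using mul_T[of A x 1] by simp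

lemma mul_T_power: "mul A ((T l ^^ n) 1) = (T l ^^ n) A"
  by (induction n) (simp_all add: mul_T)

lemma T_power_linear: "Vector_Spaces.linear scaleS scaleS (T l ^^ n)"
  by (induction n) (simp_all add: linear_S_iff S.vector_space_axioms T_add T_scale)

lemma T_power_scale: "(T l ^^ n) (scaleS c X) = scaleS c ((T l ^^ n) X)"
  using T_power_linear by (simp add: linear_S_iff)

lemma cop_T_power:
  assumes "bilinear \<beta>"
  shows "cop \<beta> ((T l ^^ n) 1) =
    (\<Sum>j\<le>n. scaleS (of_nat (n choose j)) (\<beta> ((T l ^^ j) 1) ((T l ^^ (n - j)) 1)))"
  using assms
proof (induction n arbitrary: \<beta>)
  case (Suc n)
  have "cop \<beta> ((T l ^^ Suc n) 1) =
    (\<Sum>j\<le>n. scaleS (of_nat (n choose j)) (\<beta> ((T l ^^ Suc j) 1) ((T l ^^ (Suc n - Suc j)) 1))) +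
    (\<Sum>j\<le>n. scaleS (of_nat (n choose j)) (\<beta> ((T l ^^ j) 1) ((T l ^^ Suc (n - j)) 1)))"
    using Suc.IH[OF bilinear_compose_left[OF Suc.prems T_linear]]
      Suc.IH[OF bilinear_compose_right[OF Suc.prems T_linear]]
    by (simp add: cop_T Suc.prems)
  also have "(\<Sum>j\<le>n. scaleS (of_nat (n choose j)) (\<beta> ((T l ^^ j) 1) ((T l ^^ Suc (n - j)) 1))) =
    (\<Sum>j\<le>n. scaleS (of_nat (n choose j)) (\<beta> ((T l ^^ j) 1) ((T l ^^ (Suc n - j)) 1)))"
    by (intro sum.cong) (simp_all add: Suc_diff_le)
  finally show ?case unfolding sum_choose_Suc .
qed simp

text \<open>
  \<open>psi k\<close> is the \<open>k\<close>-fold convolution power of the identity, and \<open>Q j\<close> the \<open>j\<close>-fold convolution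
  power of the identity minus the counit.
\<close>

primrec psi :: "nat \<Rightarrow> 's \<Rightarrow> 's" where
  "psi 0 = eps"
| "psi (Suc k) = cop (\<lambda>X Y. mul (psi k X) Y)"

primrec Q :: "nat \<Rightarrow> 's \<Rightarrow> 's" where
  "Q 0 = eps"
| "Q (Suc j) = cop (\<lambda>X Y. mul (Q j X) (Y - eps Y))"

lemma psi_linear: "Vector_Spaces.linear scaleS scaleS (psi k)"
  by (induction k) (simp_all add: eps_linear cop_linear bilinear_compose_left bilinear_mul)

lemma eps_compl_linear: "Vector_Spaces.linear scaleS scaleS (\<lambda>Y. Y - eps Y)"
  by (simp add: linear_S_iff S.vector_space_axioms eps_add eps_scale S.scale_right_diff_distrib)

lemma Q_linear: "Vector_Spaces.linear scaleS scaleS (Q j)"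
  by (induction j)
    (simp_all add: eps_linear cop_linear bilinear_compose[OF bilinear_mul _ eps_compl_linear])

lemma Q_bilinear: "bilinear (\<lambda>X Y. mul (Q j X) (Y - eps Y))"
  by (rule bilinear_compose[OF bilinear_mul Q_linear eps_compl_linear])

lemma eps_T [simp]: "eps (T b X) = 0"
proof -
  have "eps (der b X) = 0"
    by (induction X rule: sym_induct)
      (simp_all add: der_mult der_add der_scale eps_add eps_scale, use eps_scale[of 0 0] in simp)
  then show ?thesis by (simp add: T_def eps_add)
qed

text \<open>By \<open>cop_T_power\<close>, and since powers of one element multiply by adding
  exponents, the induction step is the binomial theorem for \<open>(k + 1) ^ n\<close>.\<close>

lemma psi_T_power: "psi k ((T l ^^ n) 1) = scaleS (of_nat k ^ n) ((T l ^^ n) 1)"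
proof (induction k arbitrary: n)
  case 0
  then show ?case by (cases n) simp_all
next
  case (Suc k)
  have funpow: "(T l ^^ (n - j)) ((T l ^^ j) 1) = (T l ^^ n) 1" if "j \<le> n" for j
    using that by (metis funpow_add comp_apply le_add_diff_inverse2)
  have "psi (Suc k) ((T l ^^ n) 1) =
    (\<Sum>j\<le>n. scaleS (of_nat (n choose j)) (scaleS (of_nat k ^ j) ((T l ^^ n) 1)))"
    by (simp add: cop_T_power bilinear_compose_left bilinear_mul psi_linear mul_T_power
        T_power_scale Suc funpow del: S.scale_scale)
  also have "\<dots> = scaleS ((of_nat k + 1) ^ n) ((T l ^^ n) 1)"
    by (simp add: binomial_ring S.scale_sum_left)
  finally show ?case by (simp add: add.commute)
qed

text \<open>The identity is the sum of \<open>Y - eps Y\<close> and \<open>eps Y\<close>, and the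
  latter is neutral for convolution, so this is a binomial expansion.\<close>

lemma psi_eq_sum_Q: "psi k X = (\<Sum>j\<le>k. scaleS (of_nat (k choose j)) (Q j X))"
proof (induction k arbitrary: X)
  case (Suc k)
  have left: "bilinear (\<lambda>X Y. mul (Q j X) Y)" for j
    by (rule bilinear_compose_left[OF bilinear_mul Q_linear])
  have right: "bilinear (\<lambda>X Y. mul (Q j X) (eps Y))" for j
    by (rule bilinear_compose_right[OF left eps_linear])
  have split: "mul (Q j X) Y = mul (Q j X) (Y - eps Y) + mul (Q j X) (eps Y)" for j X Y
    by (metis mul_add_right diff_add_cancel)
  have sum_left: "mul (\<Sum>j\<le>k. scaleS (of_nat (k choose j)) (Q j X)) Y =
      (\<Sum>j\<le>k. scaleS (of_nat (k choose j)) (mul (Q j X) Y))" for X Y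
  proof -
    interpret m: Vector_Spaces.linear scaleS scaleS "\<lambda>X. mul X Y"
      using bilinear_mul by (simp add: bilinear_def)
    show ?thesis by (simp add: m.sum m.scale)
  qed
  have cop_Q: "cop (\<lambda>X Y. mul (Q j X) Y) X = Q (Suc j) X + Q j X" for j
  proof -
    have "cop (\<lambda>X Y. mul (Q j X) Y) X = cop (\<lambda>X Y. mul (Q j X) (Y - eps Y) + mul (Q j X) (eps Y)) X"
      by (simp flip: split)
    also have "\<dots> = Q (Suc j) X + Q j X"
      using cop_eps_right[OF left] by (simp add: cop_add[OF Q_bilinear right])
    finally show ?thesis .
  qed
  have "psi (Suc k) X = (\<Sum>j\<le>k. scaleS (of_nat (k choose j)) (Q (Suc j) X + Q j X))"
    by (simp add: Suc.IH[abs_def] sum_left cop_sum cop_scale bilinear_scale left cop_Q del: Q.simps)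
  then show ?case
    unfolding sum_choose_Suc by (simp add: S.scale_right_distrib sum.distrib del: Q.simps)
qed simp

text \<open>Subtracting \<open>eps\<close> removes exactly the term with an empty last block: for
  \<open>I = A\<close> the right factor is 1 minus 1, and for the other \<open>I\<close> its
  \<open>eps\<close> vanishes.\<close>

lemma Q_Suc_prod:
  assumes "finite A"
  shows "Q (Suc j) (\<Prod>k\<in>A. \<iota> (l k)) =
    (\<Sum>I\<in>Pow A - {A}. mul (Q j (\<Prod>k\<in>I. \<iota> (l k))) (\<Prod>k\<in>A - I. \<iota> (l k)))"
proof -
  let ?t = "\<lambda>I. mul (Q j (\<Prod>k\<in>I. \<iota> (l k))) ((\<Prod>k\<in>A - I. \<iota> (l k)) - eps (\<Prod>k\<in>A - I. \<iota> (l k)))"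
  have "?t A = 0" using mul_scale_right[of _ 0 0] by simp
  then have "(\<Sum>I\<in>Pow A. ?t I) = (\<Sum>I\<in>Pow A - {A}. ?t I)"
    using assms by (simp add: sum.remove[of "Pow A" A])
  also have "\<dots> = (\<Sum>I\<in>Pow A - {A}. mul (Q j (\<Prod>k\<in>I. \<iota> (l k))) (\<Prod>k\<in>A - I. \<iota> (l k)))"
    using assms by (intro sum.cong) (auto simp: eps_prod)
  finally show ?thesis by (simp add: cop_prod assms Q_bilinear)
qed

lemma Q_prod:
  assumes "finite A"
  shows "Q j (\<Prod>k\<in>A. \<iota> (l k)) =
    (\<Sum>Is\<in>ordered_partitions A j. star_list (map (\<lambda>I. \<Prod>k\<in>I. \<iota> (l k)) Is))"
  using assms
proof (induction j arbitrary: A)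
  case 0
  have "ordered_partitions A 0 = (if A = {} then {[]} else {})"
    by (auto simp: ordered_partitions_def partition_on_def)
  then show ?case using 0 by (simp add: eps_prod)
next
  case (Suc j)
  have "Q (Suc j) (\<Prod>k\<in>A. \<iota> (l k)) = (\<Sum>I\<in>Pow A - {A}. \<Sum>Is\<in>ordered_partitions I j.
      mul (star_list (map (\<lambda>I. \<Prod>k\<in>I. \<iota> (l k)) Is)) (\<Prod>k\<in>A - I. \<iota> (l k)))"
    unfolding Q_Suc_prod[OF Suc.prems]
  proof (rule sum.cong)
    fix I assume "I \<in> Pow A - {A}"
    then have "finite I" using Suc.prems finite_subset by auto
    interpret m: Vector_Spaces.linear scaleS scaleS "\<lambda>X. mul X (\<Prod>k\<in>A - I. \<iota> (l k))"
      using bilinear_mul by (simp add: bilinear_def)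
    show "mul (Q j (\<Prod>k\<in>I. \<iota> (l k))) (\<Prod>k\<in>A - I. \<iota> (l k)) =
      (\<Sum>Is\<in>ordered_partitions I j.
        mul (star_list (map (\<lambda>I. \<Prod>k\<in>I. \<iota> (l k)) Is)) (\<Prod>k\<in>A - I. \<iota> (l k)))"
      by (simp add: Suc.IH \<open>finite I\<close> m.sum)
  qed simp
  then show ?case by (simp add: sum_ordered_partitions_Suc Suc.prems del: Q.simps)
qed

text \<open>Every convolution step uses up a nonempty block, and there are fewer than
  \<open>j\<close> elements. On a fixed monomial this bounds the relevant \<open>Q j\<close>
  independently of \<open>k\<close>.\<close>

lemma Q_prod_eq_0:
  assumes "finite A" "card A < j"
  shows "Q j (\<Prod>k\<in>A. \<iota> (l k)) = 0"
  using assms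
proof (induction j arbitrary: A)
  case (Suc j)
  have "mul (Q j (\<Prod>k\<in>I. \<iota> (l k))) Y = 0" if "I \<in> Pow A - {A}" for I Y
  proof -
    have "card I < card A" "finite I"
      using that Suc.prems(1) by (auto intro: psubset_card_mono finite_subset)
    then have "Q j (\<Prod>k\<in>I. \<iota> (l k)) = 0" using Suc by simp
    then show ?thesis using mul_scale_left[of 0 0] by simp
  qed
  then show ?case unfolding Q_Suc_prod[OF Suc.prems(1)] by (simp add: sum.neutral)
qed simp

lemma Q_monomial_eq_0: "size M < j \<Longrightarrow> Q j (monomial M) = 0"
  by (metis Q_prod_eq_0 monomial_as_prod card_atLeastAtMost diff_Suc_1 finite_atLeastAtMost)

end

context symmetric_algebra
begin

text \<open>By symmetry, linearity in the last argument is enough.\<close>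

lemma sym_lift_fun:
  assumes V: "vector_space scaleV"
    and cong: "\<And>n x y. (\<And>i. i \<in> {1..n} \<Longrightarrow> x i = y i) \<Longrightarrow> F n x = F n y"
    and perm: "\<And>n x p. p permutes {1..n} \<Longrightarrow> F n (x \<circ> p) = F n x"
    and add: "\<And>n x u v. F (Suc n) (x(Suc n := u + v)) = F (Suc n) (x(Suc n := u)) + F (Suc n) (x(Suc n := v))"
    and scale: "\<And>n x c u. F (Suc n) (x(Suc n := scale c u)) = scaleV c (F (Suc n) (x(Suc n := u)))"
  obtains g where "Vector_Spaces.linear scaleS scaleV g"
    "\<And>(n::nat) x. g (\<Prod>i=1..n. \<iota> (x i)) = F n x"
proof -
  \<comment> \<open>The multiset is enumerated arbitrarily; two enumerations differ by a
    permutation, so \<open>perm\<close> makes the choice harmless.\<close>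
  define \<phi> where
    "\<phi> M = F (size M) (SOME x. image_mset x (mset_set {1..size M}) = M)" for M :: "'l multiset"
  have \<phi>: "\<phi> (image_mset x (mset_set {1..n})) = F n x" for n x
  proof -
    define y where "y = (SOME y. image_mset y (mset_set {1..n}) = image_mset x (mset_set {1..n}))"
    have "image_mset y (mset_set {1..n}) = image_mset x (mset_set {1..n})"
      using someI[of "\<lambda>y. image_mset y (mset_set {1..n}) = image_mset x (mset_set {1..n})" x]
      by (simp add: y_def)
    then obtain p where p: "p permutes {1..n}" "\<forall>i\<in>{1..n}. y i = x (p i)"
      using image_mset_eq_implies_permutes[of "{1..n}" y x] by blast
    then have "F n y = F n (x \<circ> p)" by (intro cong) simp
    then show ?thesis using perm[OF p(1)] by (simp add: \<phi>_def y_def)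
  qed
  have \<phi>_Suc: "\<phi> (add_mset u (image_mset x (mset_set {1..n}))) = F (Suc n) (x(Suc n := u))" for u x n
  proof -
    have "image_mset (x(Suc n := u)) (mset_set {1..n}) = image_mset x (mset_set {1..n})"
      by (rule image_mset_cong) auto
    then have "image_mset (x(Suc n := u)) (mset_set {1..Suc n}) = add_mset u (image_mset x (mset_set {1..n}))"
      by (simp add: atLeastAtMostSuc_conv)
    then show ?thesis using \<phi>[of "x(Suc n := u)" "Suc n"] by simp
  qed
  have "multilinear scaleV \<phi>"
    unfolding multilinear_def
  proof (intro conjI allI)
    fix M :: "'l multiset" and u v c
    obtain x where x: "M = image_mset x (mset_set {1..size M})"
      using monomial_as_prod[of M] by blast
    show "\<phi> (add_mset (u + v) M) = \<phi> (add_mset u M) + \<phi> (add_mset v M)"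
      by (subst (1 2 3) x) (simp only: \<phi>_Suc add)
    show "\<phi> (add_mset (scale c u) M) = scaleV c (\<phi> (add_mset u M))"
      by (subst (1 2) x) (simp only: \<phi>_Suc scale)
  qed
  then obtain g where g: "Vector_Spaces.linear scaleS scaleV g" "\<And>M. g (monomial M) = \<phi> M"
    using sym_lift[OF V] by blast
  have "g (\<Prod>i=1..n. \<iota> (x i)) = F n x" for n :: nat and x
    using g(2)[of "image_mset x (mset_set {1..n})"] by (simp only: \<phi> monomial_image finite_atLeastAtMost)
  with g(1) show thesis by (rule that)
qed

end

context prelie_symmetric
begin

subsection \<open>The PBW decomposition\<close>

text \<open>Polarization: the factors of a monomial are traded one at a time for a higher power. In
  the expansion of \<open>(t y + x) ^ Suc m\<close> the coefficient of \<open>t\<close> is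
  \<open>Suc m\<close> times \<open>x ^ m y\<close>; \<open>vandermonde\<close> extracts it, and
  characteristic zero permits the division.\<close>

lemma sym_power_eq_span_powers: "sym_power n = S.span (range (\<lambda>x. \<iota> x ^ n))"
proof
  let ?W = "S.span (range (\<lambda>x. \<iota> x ^ n))"
  have polarize: "\<iota> x ^ m * monomial M \<in> ?W" if "size M + m = n" for x m M
    using that
  proof (induction M arbitrary: x m)
    case empty
    then show ?case by (auto intro: S.span_base)
  next
    case (add y M)
    define v where "v j = of_nat (Suc m choose j) * \<iota> y ^ j * \<iota> x ^ (Suc m - j) * monomial M" for j
    have "(\<Sum>j\<le>Suc m. scaleS (of_nat t ^ j) (v j)) \<in> ?W" for t :: nat
    proof -
      have pow: "scaleS c X ^ j = scaleS (c ^ j) (X ^ j)" for c X j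
        by (induction j) (simp_all add: scaleS_mult_right flip: scaleS_mult)
      have "\<iota> (scale (of_nat t) y + x) ^ Suc m * monomial M = (\<Sum>j\<le>Suc m. scaleS (of_nat t ^ j) (v j))"
        unfolding v_def iota_add iota_scale binomial_ring sum_distrib_right
        by (intro sum.cong) (simp_all add: pow scaleS_mult_right flip: scaleS_mult)
      moreover have "\<iota> (scale (of_nat t) y + x) ^ Suc m * monomial M \<in> ?W"
        by (rule add.IH) (use add.prems in simp)
      ultimately show ?thesis by simp
    qed
    then have "v 1 \<in> ?W" by (rule vandermonde[OF S.subspace_span]) simp
    moreover have "of_nat k * X = scaleS (of_nat k) X" for k X
      by (induction k) (simp_all add: S.scale_left_distrib distrib_right)
    moreover have "v 1 = of_nat (Suc m) * (\<iota> x ^ m * monomial (add_mset y M))"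
      by (simp add: v_def mult.assoc mult.left_commute del: of_nat_Suc)
    ultimately have "scaleS (inverse (of_nat (Suc m)))
        (scaleS (of_nat (Suc m)) (\<iota> x ^ m * monomial (add_mset y M))) \<in> ?W"
      by (metis S.span_scale)
    then show ?case by (simp del: of_nat_Suc)
  qed
  have "(\<Prod>i=1..n. \<iota> (x i)) \<in> ?W" for x
    using polarize[of "image_mset x (mset_set {1..n})" 0] by (simp add: monomial_image)
  then show "sym_power n \<subseteq> ?W"
    unfolding sym_power_def by (intro S.span_minimal) auto
  have "range (\<lambda>x. \<iota> x ^ n) \<subseteq> range (\<lambda>x :: nat \<Rightarrow> 'l. \<Prod>i=1..n. \<iota> (x i))"
    by (auto intro: range_eqI[of _ _ "\<lambda>_. _"])
  then show "?W \<subseteq> sym_power n"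
    unfolding sym_power_def by (rule S.span_mono)
qed

lemma T_power_eq_foldl: "(T l ^^ n) 1 = star_list (replicate n (\<iota> l))"
  by (induction n) (simp_all add: replicate_append_same[symmetric] mul_iota)

lemma foldl_mul_add: "foldl mul (X + Y) Zs = foldl mul X Zs + foldl mul Y Zs"
  and foldl_mul_scale: "foldl mul (scaleS c X) Zs = scaleS c (foldl mul X Zs)"
  by (induction Zs arbitrary: X Y) (simp_all add: mul_add_left mul_scale_left)

text \<open>\<open>\<sigma>\<close> determines the single position of \<open>u\<close>, and the
  words before and after it do not involve \<open>u\<close>. Hence each summand of the
  symmetrization is linear in \<open>u\<close>.\<close>

lemma star_list_permuted_eq:
  assumes "\<sigma> permutes {1..Suc n}"
  obtains Xs Ys where
    "\<And>u. star_list (map (\<lambda>i. \<iota> ((x(Suc n := u)) (\<sigma> i))) [1..<Suc (Suc n)]) =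
      foldl mul (mul (star_list Xs) (\<iota> u)) Ys"
proof -
  define k where "k = inv \<sigma> (Suc n)"
  have \<sigma>k: "\<sigma> k = Suc n" using assms permutes_inverses(1) by (fastforce simp: k_def)
  have "k \<in> {1..Suc n}" using permutes_in_image[OF permutes_inv[OF assms], of "Suc n"] by (simp add: k_def)
  then have upt: "[1..<Suc (Suc n)] = [1..<k] @ k # [Suc k..<Suc (Suc n)]"
    using upt_add_eq_append[of 1 k "Suc (Suc n) - k"] by (simp add: upt_conv_Cons del: upt_Suc)
  have ne: "\<sigma> i \<noteq> Suc n" if "i \<noteq> k" for i
    using \<sigma>k that permutes_inj[OF assms] by (metis injD)
  have "star_list (map (\<lambda>i. \<iota> ((x(Suc n := u)) (\<sigma> i))) [1..<Suc (Suc n)]) =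
      foldl mul (mul (star_list (map (\<lambda>i. \<iota> (x (\<sigma> i))) [1..<k])) (\<iota> u))
        (map (\<lambda>i. \<iota> (x (\<sigma> i))) [Suc k..<Suc (Suc n)])" for u
  proof -
    have "map (\<lambda>i. \<iota> ((x(Suc n := u)) (\<sigma> i))) [1..<k] = map (\<lambda>i. \<iota> (x (\<sigma> i))) [1..<k]"
      "map (\<lambda>i. \<iota> ((x(Suc n := u)) (\<sigma> i))) [Suc k..<Suc (Suc n)] =
        map (\<lambda>i. \<iota> (x (\<sigma> i))) [Suc k..<Suc (Suc n)]"
      using ne by (auto simp del: upt_Suc)
    then show ?thesis
      by (simp only: upt map_append list.map foldl_append foldl.simps \<sigma>k star_list_def star_eq fun_upd_same)
  qed
  then show thesis by (rule that)
qed

lemma is_pbw_unique: "is_pbw e \<Longrightarrow> is_pbw e' \<Longrightarrow> e = e'"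
proof (rule linear_eqI)
  fix M assume e: "is_pbw e" "is_pbw e'"
  obtain l where "monomial M = (\<Prod>i=1..size M. \<iota> (l i))" by (rule monomial_as_prod)
  then show "e (monomial M) = e' (monomial M)" using e by (simp only: is_pbw_def)
qed (auto simp: is_pbw_def)

text \<open>Symmetrization is well defined by \<open>sym_lift_fun\<close>: permutation invariance is
  a reindexing of the sum, and linearity in the last argument comes from
  \<open>star_list_permuted_eq\<close>.\<close>

lemma is_pbw_pbw: "is_pbw pbw"
proof -
  let ?F = "\<lambda>n x. scaleS (1 / fact n)
    (\<Sum>\<sigma> | \<sigma> permutes {1..n}. star_list (map (\<lambda>i. \<iota> (x (\<sigma> i))) [1..<Suc n]))"
  obtain e where "Vector_Spaces.linear scaleS scaleS e" "\<And>(n::nat) l. e (\<Prod>i=1..n. \<iota> (l i)) = ?F n l"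
  proof (rule sym_lift_fun[OF S.vector_space_axioms, of ?F])
    fix n :: nat and x y :: "nat \<Rightarrow> 'l" assume xy: "\<And>i. i \<in> {1..n} \<Longrightarrow> x i = y i"
    have "map (\<lambda>i. \<iota> (x (\<sigma> i))) [1..<Suc n] = map (\<lambda>i. \<iota> (y (\<sigma> i))) [1..<Suc n]"
      if "\<sigma> permutes {1..n}" for \<sigma>
      using permutes_in_image[OF that] xy by (auto simp del: upt_Suc)
    then show "?F n x = ?F n y" 
      by (intro arg_cong[of _ _ "scaleS _"] sum.cong refl) (simp only: mem_Collect_eq)
  next
    fix n :: nat and x :: "nat \<Rightarrow> 'l" and p assume "p permutes {1..n}"
    from setum_permutations_compose_left[OF this,
        of "\<lambda>\<sigma>. star_list (map (\<lambda>i. \<iota> (x (\<sigma> i))) [1..<Suc n])"]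
    show "?F n (x \<circ> p) = ?F n x" by (simp only: comp_apply)
  next
    fix n :: nat and x :: "nat \<Rightarrow> 'l" and u v
    show "?F (Suc n) (x(Suc n := u + v)) = ?F (Suc n) (x(Suc n := u)) + ?F (Suc n) (x(Suc n := v))"
      unfolding S.scale_right_distrib[symmetric] sum.distrib[symmetric]
    proof (intro arg_cong[of _ _ "scaleS _"] sum.cong refl)
      fix \<sigma> assume "\<sigma> \<in> {\<sigma>. \<sigma> permutes {1..Suc n}}"
      then obtain Xs Ys where
        "\<And>u. star_list (map (\<lambda>i. \<iota> ((x(Suc n := u)) (\<sigma> i))) [1..<Suc (Suc n)]) =
          foldl mul (mul (star_list Xs) (\<iota> u)) Ys"
        using star_list_permuted_eq by blast
      then show "star_list (map (\<lambda>i. \<iota> ((x(Suc n := u + v)) (\<sigma> i))) [1..<Suc (Suc n)]) =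
        star_list (map (\<lambda>i. \<iota> ((x(Suc n := u)) (\<sigma> i))) [1..<Suc (Suc n)]) +
        star_list (map (\<lambda>i. \<iota> ((x(Suc n := v)) (\<sigma> i))) [1..<Suc (Suc n)])"
        by (simp only: iota_add mul_add_right foldl_mul_add)
    qed
  next
    fix n :: nat and x :: "nat \<Rightarrow> 'l" and c u
    show "?F (Suc n) (x(Suc n := scale c u)) = scaleS c (?F (Suc n) (x(Suc n := u)))"
      unfolding S.scale_left_commute[of c] S.scale_sum_right[of c]
    proof (intro arg_cong[of _ _ "scaleS _"] sum.cong refl)
      fix \<sigma> assume "\<sigma> \<in> {\<sigma>. \<sigma> permutes {1..Suc n}}"
      then obtain Xs Ys where
        "\<And>u. star_list (map (\<lambda>i. \<iota> ((x(Suc n := u)) (\<sigma> i))) [1..<Suc (Suc n)]) =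
          foldl mul (mul (star_list Xs) (\<iota> u)) Ys"
        using star_list_permuted_eq by blast
      then show "star_list (map (\<lambda>i. \<iota> ((x(Suc n := scale c u)) (\<sigma> i))) [1..<Suc (Suc n)]) =
        scaleS c (star_list (map (\<lambda>i. \<iota> ((x(Suc n := u)) (\<sigma> i))) [1..<Suc (Suc n)]))"
        by (simp only: iota_scale mul_scale_right foldl_mul_scale)
    qed
  qed (rule that)
  then have e: "is_pbw e" unfolding is_pbw_def by blast
  from e is_pbw_unique[OF _ e] show ?thesis unfolding pbw_def by (rule theI)
qed

lemma pbw_power: "pbw (\<iota> l ^ n) = (T l ^^ n) 1"
proof -
  have "pbw (\<Prod>i=1..n. \<iota> l) = scaleS (1 / fact n)
      (\<Sum>\<sigma> | \<sigma> permutes {1..n}. star_list (map (\<lambda>i. \<iota> l) [1..<Suc n]))"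
    using is_pbw_pbw[unfolded is_pbw_def, THEN conjunct2, rule_format, of "\<lambda>_. l" n] .
  also have "map (\<lambda>i. \<iota> l) [1..<Suc n] = replicate n (\<iota> l)"
    by (simp add: map_replicate_const del: upt_Suc)
  also have "scaleS (1 / fact n) (\<Sum>\<sigma> | \<sigma> permutes {1..n}. star_list (replicate n (\<iota> l))) = (T l ^^ n) 1"
    by (simp add: T_power_eq_foldl S.sum_constant_scale card_permutations[OF refl] del: sum_constant)
  finally show ?thesis by simp
qed

text \<open>By polarization only the powers of single elements have to be symmetrized, and these are
  the elements on which \<open>psi\<close> is known.\<close>

lemma pbw_component_eq: "pbw_component n = S.span (range (\<lambda>l. (T l ^^ n) 1))"
proof -
  interpret pbw: Vector_Spaces.linear scaleS scaleS pbw
    using is_pbw_pbw by (simp add: is_pbw_def)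
  show ?thesis
    by (simp add: pbw_component_def sym_power_eq_span_powers image_image pbw_power
        flip: pbw.span_image)
qed

section \<open>The degree filtration, and spanning by powers for the enveloping product\<close>

definition filt :: "nat \<Rightarrow> 's set" where
  "filt n = S.span (monomial ` {M. size M \<le> n})"

lemma filt_mono: "m \<le> n \<Longrightarrow> filt m \<subseteq> filt n"
  unfolding filt_def by (intro S.span_mono image_mono) auto

lemma iota_mult_filt:
  assumes "X \<in> filt n" shows "\<iota> x * X \<in> filt (Suc n)"
  using assms unfolding filt_def
proof (induction rule: S.span_induct)
  case base
  show ?case by (rule S.subspaceI)
      (simp_all add: S.span_zero S.span_add S.span_scale distrib_left scaleS_mult_right)
next
  case (step Y)
  then obtain M where "Y = monomial M" "size M \<le> n" by blast
  then show ?case by (intro S.span_base image_eqI[of _ _ "add_mset x M"]) auto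
qed

lemma der_filt:
  assumes "X \<in> filt n" shows "der b X \<in> filt n"
  using assms unfolding filt_def
proof (induction rule: S.span_induct)
  case base
  show ?case using der_scale[of b 0 0] by (intro S.subspaceI)
      (simp_all add: S.span_zero S.span_add S.span_scale der_add der_scale)
next
  case (step Y)
  then obtain M where M: "Y = monomial M" "size M \<le> n" by blast
  then have "monomial ` {N. size N = size M} \<subseteq> monomial ` {M. size M \<le> n}" by auto
  from S.span_mono[OF this] show ?case using der_monomial[of b M] M(1) by blast
qed

lemma T_filt: "X \<in> filt n \<Longrightarrow> T b X \<in> filt (Suc n)"
  using filt_mono[of n "Suc n"] der_filt[of X n b] iota_mult_filt[of X n b]
  unfolding T_def filt_def by (auto intro: S.span_add)

lemma T_power_filt: "(T l ^^ n) 1 \<in> filt n"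
proof (induction n)
  case 0
  have "monomial {#} \<in> filt 0" unfolding filt_def by (intro S.span_base) auto
  then show ?case by simp
qed (simp add: T_filt)

text \<open>\<open>T l\<close> differs from multiplication by \<open>\<iota> l\<close> only by
  \<open>der l\<close>, which raises no degree, so both powers have the same top part.\<close>

lemma power_diff_T_power_filt: "\<iota> l ^ Suc n - (T l ^^ Suc n) 1 \<in> filt n"
proof (induction n)
  case 0
  then show ?case by (simp add: filt_def S.span_zero)
next
  case (Suc n)
  have "\<iota> l ^ Suc (Suc n) - (T l ^^ Suc (Suc n)) 1 =
    \<iota> l * (\<iota> l ^ Suc n - (T l ^^ Suc n) 1) - der l ((T l ^^ Suc n) 1)"
    by (simp add: T_def[of l "T l _"] algebra_simps)
  also have "\<dots> \<in> filt (Suc n)"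
    using iota_mult_filt[OF Suc] der_filt[OF T_power_filt[of "Suc n" l]]
    unfolding filt_def by (rule S.span_diff)
  finally show ?case .
qed

text \<open>The PBW components together exhaust S(L). In the induction over the filtration,
  monomials of top degree are combinations of symmetric powers, and these agree with the powers for
  the enveloping product up to lower degree.\<close>

lemma span_T_powers: "S.span (\<Union>n. range (\<lambda>l. (T l ^^ n) 1)) = UNIV"
proof -
  let ?U = "S.span (\<Union>n. range (\<lambda>l. (T l ^^ n) 1))"
  have T_power: "(T l ^^ n) 1 \<in> ?U" for l n by (blast intro: S.span_base)
  have "filt n \<subseteq> ?U" for n
  proof (induction n)
    case 0
    then show ?case
      unfolding filt_def using T_power[of 0] by (intro S.span_minimal) auto
  next
    case (Suc n)
    have "\<iota> l ^ Suc n \<in> ?U" for l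
      using S.span_add[OF T_power[of "Suc n"] Suc[THEN subsetD, OF power_diff_T_power_filt]]
      by (metis add.commute diff_add_cancel)
    then have sym: "sym_power (Suc n) \<subseteq> ?U"
      unfolding sym_power_eq_span_powers by (intro S.span_minimal) auto
    have "monomial M \<in> ?U" if "size M \<le> Suc n" for M
    proof (cases "size M = Suc n")
      case True
      obtain l where "monomial M = (\<Prod>i=1..size M. \<iota> (l i))" by (rule monomial_as_prod)
      then have "monomial M \<in> sym_power (Suc n)"
        unfolding sym_power_def True by (intro S.span_base) auto
      with sym show ?thesis by blast
    next
      case False
      with that have "monomial M \<in> filt n" unfolding filt_def by (intro S.span_base) auto
      with Suc show ?thesis by blast
    qed
    then show ?case unfolding filt_def by (intro S.span_minimal) auto
  qed
  moreover have "monomial M \<in> filt (size M)" for M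
    unfolding filt_def by (intro S.span_base) auto
  ultimately have "S.span (range monomial) \<subseteq> ?U" by (intro S.span_minimal) auto
  then show ?thesis using span_monomials by blast
qed

text \<open>The Eulerian idempotents, in the form of the theorem. The upper limit of the sum depends
  on the degree, so the formula is imposed on monomials and extended linearly.\<close>

definition eul :: "nat \<Rightarrow> 's \<Rightarrow> 's" where
  "eul i = (SOME g. Vector_Spaces.linear scaleS scaleS g \<and> (\<forall>M. g (monomial M) =
     (\<Sum>j=i..size M. scaleS (of_int (signed_stirling1 j i) / fact j) (Q j (monomial M)))))"

lemma eul_linear: "Vector_Spaces.linear scaleS scaleS (eul i)" (is ?lin)
  and eul_monomial: "eul i (monomial M) =
    (\<Sum>j=i..size M. scaleS (of_int (signed_stirling1 j i) / fact j) (Q j (monomial M)))" (is ?mono)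
proof -
  have Q: "Q j (X + Y) = Q j X + Q j Y" "Q j (scaleS c X) = scaleS c (Q j X)" for j X Y c
    using Q_linear by (simp_all add: linear_S_iff)
  have monomial: "monomial (add_mset (x + y) M) = monomial (add_mset x M) + monomial (add_mset y M)"
    "monomial (add_mset (scale c x) M) = scaleS c (monomial (add_mset x M))" for x y M c
    by (simp_all add: iota_add iota_scale distrib_right flip: scaleS_mult)
  have "multilinear scaleS (\<lambda>M. \<Sum>j=i..size M.
      scaleS (of_int (signed_stirling1 j i) / fact j) (Q j (monomial M)))"
    by (simp only: multilinear_def monomial size_add_mset Q S.scale_right_distrib sum.distrib
        S.scale_sum_right S.scale_scale mult.commute simp_thms)
  then have "\<exists>g. Vector_Spaces.linear scaleS scaleS g \<and> (\<forall>M. g (monomial M) =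
     (\<Sum>j=i..size M. scaleS (of_int (signed_stirling1 j i) / fact j) (Q j (monomial M))))"
    using sym_lift[OF S.vector_space_axioms] by blast
  from someI_ex[OF this] show ?lin ?mono unfolding eul_def by blast+
qed

text \<open>All sums can be given the range up to \<open>N\<close>, since \<open>Q j\<close>
  vanishes above the degree and the Stirling numbers vanish for \<open>j < i\<close>. After
  exchanging them, \<open>sum_signed_stirling1\<close> recovers the expansion
  \<open>psi_eq_sum_Q\<close>.\<close>

lemma psi_monomial_eq_sum_eul:
  assumes "size M \<le> N"
  shows "psi k (monomial M) = (\<Sum>i\<le>N. scaleS (of_nat k ^ i) (eul i (monomial M)))"
proof -
  let ?q = "\<lambda>j. Q j (monomial M)"
  have eul: "eul i (monomial M) = (\<Sum>j\<le>N. scaleS (of_int (signed_stirling1 j i) / fact j) (?q j))" for i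
    unfolding eul_monomial
    by (rule sum.mono_neutral_left)
      (use assms in \<open>auto simp: Q_monomial_eq_0 signed_stirling1_eq_0 not_le\<close>)
  have "(\<Sum>i\<le>N. scaleS (of_nat k ^ i) (eul i (monomial M))) =
    (\<Sum>i\<le>N. \<Sum>j\<le>N. scaleS (of_nat k ^ i * (of_int (signed_stirling1 j i) / fact j)) (?q j))"
    by (simp add: eul S.scale_sum_right)
  also have "\<dots> = (\<Sum>j\<le>N. \<Sum>i\<le>N. scaleS (of_nat k ^ i * (of_int (signed_stirling1 j i) / fact j)) (?q j))"
    by (rule sum.swap)
  also have "\<dots> = (\<Sum>j\<le>N. scaleS (of_nat (k choose j)) (?q j))"
    by (intro sum.cong refl) (simp only: S.scale_sum_left[symmetric] sum_signed_stirling1 atMost_iff)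
  also have "\<dots> = (\<Sum>j\<le>max k N. scaleS (of_nat (k choose j)) (?q j))"
    by (rule sum.mono_neutral_left) (use assms in \<open>auto simp: Q_monomial_eq_0 not_le\<close>)
  also have "\<dots> = (\<Sum>j\<le>k. scaleS (of_nat (k choose j)) (?q j))"
    by (rule sum.mono_neutral_right) (auto simp: binomial_eq_0 not_le)
  finally show ?thesis by (simp add: psi_eq_sum_Q)
qed

text \<open>The bound depends on \<open>X\<close> but not on \<open>k\<close>, so on each element
  \<open>psi k\<close> is a polynomial in \<open>k\<close>. For a sum of two elements the larger
  bound works.\<close>

lemma psi_eq_sum_eul:
  "\<exists>N0. \<forall>N\<ge>N0. \<forall>k. psi k X = (\<Sum>i\<le>N. scaleS (of_nat k ^ i) (eul i X))"
proof -
  have psi: "psi k (X + Y) = psi k X + psi k Y" "psi k (scaleS c X) = scaleS c (psi k X)" for k X Y c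
    using psi_linear by (simp_all add: linear_S_iff)
  have eul: "eul i (X + Y) = eul i X + eul i Y" "eul i (scaleS c X) = scaleS c (eul i X)" for i X Y c
    using eul_linear by (simp_all add: linear_S_iff)
  have 0: "psi k 0 = 0" "eul i 0 = 0" for k i
    using psi(2)[of k 0 0] eul(2)[of i 0 0] by simp_all
  have "X \<in> S.span (range monomial)" by (simp add: span_monomials)
  then show ?thesis
  proof (induction rule: S.span_induct)
    case base
    show ?case
    proof (rule S.subspaceI; unfold mem_Collect_eq)
      fix X Y
      assume "\<exists>N0. \<forall>N\<ge>N0. \<forall>k. psi k X = (\<Sum>i\<le>N. scaleS (of_nat k ^ i) (eul i X))"
        and "\<exists>N0. \<forall>N\<ge>N0. \<forall>k. psi k Y = (\<Sum>i\<le>N. scaleS (of_nat k ^ i) (eul i Y))"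
      then obtain N1 N2 where
        X: "\<And>N k. N \<ge> N1 \<Longrightarrow> psi k X = (\<Sum>i\<le>N. scaleS (of_nat k ^ i) (eul i X))" and
        Y: "\<And>N k. N \<ge> N2 \<Longrightarrow> psi k Y = (\<Sum>i\<le>N. scaleS (of_nat k ^ i) (eul i Y))" by blast
      have "psi k (X + Y) = (\<Sum>i\<le>N. scaleS (of_nat k ^ i) (eul i (X + Y)))" if "N \<ge> max N1 N2" for N k
        using that X[of N k] Y[of N k] by (simp add: psi eul S.scale_right_distrib sum.distrib)
      then show "\<exists>N0. \<forall>N\<ge>N0. \<forall>k. psi k (X + Y) = (\<Sum>i\<le>N. scaleS (of_nat k ^ i) (eul i (X + Y)))"
        by blast
    next
      fix c X
      assume "\<exists>N0. \<forall>N\<ge>N0. \<forall>k. psi k X = (\<Sum>i\<le>N. scaleS (of_nat k ^ i) (eul i X))"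
      then obtain N0 where
        X: "\<And>N k. N \<ge> N0 \<Longrightarrow> psi k X = (\<Sum>i\<le>N. scaleS (of_nat k ^ i) (eul i X))" by blast
      have "psi k (scaleS c X) = (\<Sum>i\<le>N. scaleS (of_nat k ^ i) (eul i (scaleS c X)))" if "N \<ge> N0" for N k
        using X[OF that, of k] by (simp add: psi eul S.scale_sum_right mult.commute)
      then show "\<exists>N0. \<forall>N\<ge>N0. \<forall>k. psi k (scaleS c X) = (\<Sum>i\<le>N. scaleS (of_nat k ^ i) (eul i (scaleS c X)))"
        by blast
    qed (simp add: 0)
  next
    case (step X)
    then show ?case using psi_monomial_eq_sum_eul by blast
  qed
qed

text \<open>By \<open>psi_T_power\<close> the polynomial in \<open>k\<close> with coefficients
  \<open>eul i\<close> takes the values of a single monomial \<open>k ^ n\<close>;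
  \<open>vandermonde\<close> with the zero subspace compares coefficients.\<close>

lemma eul_T_power: "eul i ((T l ^^ n) 1) = (if i = n then (T l ^^ n) 1 else 0)"
proof -
  let ?\<Lambda> = "(T l ^^ n) 1"
  obtain N0 where N0: "\<And>N k. N \<ge> N0 \<Longrightarrow> psi k ?\<Lambda> = (\<Sum>i\<le>N. scaleS (of_nat k ^ i) (eul i ?\<Lambda>))"
    using psi_eq_sum_eul by blast
  \<comment> \<open>\<open>N\<close> must reach \<open>n\<close>, so that the term in
    \<open>k ^ n\<close> occurs, and \<open>i\<close>, whose coefficient is compared.\<close>
  define N where "N = max N0 (max n i)"
  have "(\<Sum>i\<le>N. scaleS (of_nat k ^ i) (eul i ?\<Lambda> - (if i = n then ?\<Lambda> else 0))) \<in> {0}" for k :: nat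
  proof -
    have "(\<Sum>i\<le>N. scaleS (of_nat k ^ i) (if i = n then ?\<Lambda> else 0)) =
      (\<Sum>i\<le>N. if i = n then scaleS (of_nat k ^ n) ?\<Lambda> else 0)"
      by (intro sum.cong) auto
    also have "\<dots> = psi k ?\<Lambda>" by (simp add: psi_T_power N_def)
    also have "\<dots> = (\<Sum>i\<le>N. scaleS (of_nat k ^ i) (eul i ?\<Lambda>))" by (rule N0) (simp add: N_def)
    finally show ?thesis by (simp add: S.scale_right_diff_distrib sum_subtractf)
  qed
  then have "eul i ?\<Lambda> - (if i = n then ?\<Lambda> else 0) \<in> {0}"
    by (rule vandermonde[OF S.subspace_single_0]) (simp add: N_def)
  then show ?thesis by simp
qed

text \<open>\<open>eul i\<close> is the identity on the \<open>i\<close>-th component and zero on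
  the others by \<open>eul_T_power\<close>; as the components span S(L), this fixes its range and
  kernel.\<close>

lemma is_sol_eul: "is_sol i (eul i)"
proof -
  let ?P = "\<lambda>n. range (\<lambda>l. (T l ^^ n) 1)"
  let ?K = "S.span (\<Union>j\<in>-{i}. pbw_component j)"
  interpret eul: Vector_Spaces.linear scaleS scaleS "eul i" by (rule eul_linear)
  have on_comp: "eul i X = X" if "X \<in> pbw_component i" for X
    using that unfolding pbw_component_eq
    by (induction rule: S.span_induct)
      (auto intro!: S.subspaceI simp: eul.add eul.scale eul_T_power)
  have kernel: "eul i X = 0" if "X \<in> ?K" for X
  proof -
    have "pbw_component j \<subseteq> {X. eul i X = 0}" if "j \<noteq> i" for j
      unfolding pbw_component_eq using that eul.subspace_kernel
      by (intro S.span_minimal) (auto simp: eul_T_power)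
    then have "?K \<subseteq> {X. eul i X = 0}"
      using eul.subspace_kernel by (intro S.span_minimal) auto
    then show ?thesis using that by blast
  qed
  have decomp: "\<exists>Y\<in>pbw_component i. \<exists>Z\<in>?K. X = Y + Z" for X
  proof -
    have "(\<Union>n. ?P n) \<subseteq> ?P i \<union> (\<Union>j\<in>-{i}. pbw_component j)"
    proof
      fix \<Lambda> assume "\<Lambda> \<in> (\<Union>n. ?P n)"
      then obtain n where n: "\<Lambda> \<in> ?P n" by blast
      then have "\<Lambda> \<in> pbw_component n" unfolding pbw_component_eq by (rule S.span_base)
      with n show "\<Lambda> \<in> ?P i \<union> (\<Union>j\<in>-{i}. pbw_component j)" by (cases "n = i") auto
    qed
    from S.span_mono[OF this] have "X \<in> S.span (?P i \<union> (\<Union>j\<in>-{i}. pbw_component j))"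
      unfolding span_T_powers by blast
    then show ?thesis unfolding S.span_Un pbw_component_eq[of i, symmetric] by blast
  qed
  have eul_in: "eul i X \<in> pbw_component i" for X
  proof -
    obtain Y Z where "Y \<in> pbw_component i" "Z \<in> ?K" "X = Y + Z" using decomp by blast
    then show ?thesis using on_comp kernel by (simp add: eul.add)
  qed
  have "X \<in> ?K" if "eul i X = 0" for X
  proof -
    obtain Y Z where "Y \<in> pbw_component i" "Z \<in> ?K" "X = Y + Z" using decomp by blast
    then show ?thesis using on_comp kernel that by (simp add: eul.add)
  qed
  then have "{X. eul i X = 0} = ?K" using kernel by blast
  moreover have "range (eul i) = pbw_component i"
    using eul_in on_comp by (metis image_subset_iff subset_antisym subsetI range_eqI)
  ultimately show ?thesis
    unfolding is_sol_def using eul_linear on_comp eul_in by blast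
qed

text \<open>A projection is determined by its range and kernel: \<open>q\<close> fixes
  \<open>p X\<close>, and \<open>X - p X\<close> lies in the common kernel.\<close>

lemma is_sol_unique:
  assumes "is_sol i p" "is_sol i q"
  shows "p = q"
proof
  fix X
  interpret p: Vector_Spaces.linear scaleS scaleS p using assms(1) by (simp add: is_sol_def)
  interpret q: Vector_Spaces.linear scaleS scaleS q using assms(2) by (simp add: is_sol_def)
  have "p X \<in> range q" using assms unfolding is_sol_def by blast
  then have "q (p X) = p X" using assms(2) unfolding is_sol_def by fastforce
  moreover have "p (X - p X) = 0" using assms(1) by (simp add: is_sol_def p.diff)
  then have "q (X - p X) = 0" using assms unfolding is_sol_def by blast
  ultimately show "p X = q X" by (simp add: q.diff)
qed

lemma sol_eq_eul: "sol i = eul i"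
  unfolding sol_def using is_sol_eul is_sol_unique[OF _ is_sol_eul] by (rule the_equality)

lemma sol_prod:
  "sol i (\<Prod>k=1..n. \<iota> (l k)) =
    (\<Sum>j=i..n. scaleS (of_int (signed_stirling1 j i) / fact j)
      (\<Sum>Is\<in>ordered_partitions {1..n} j. star_list (map (\<lambda>I. \<Prod>k\<in>I. \<iota> (l k)) Is)))"
  using eul_monomial[of i "image_mset l (mset_set {1..n})"]
  by (simp add: sol_eq_eul monomial_image Q_prod)

end

theorem proposition3:
  fixes scale :: "'k::field_char_0 \<Rightarrow> 'l::ab_group_add \<Rightarrow> 'l"
    and pl :: "'l \<Rightarrow> 'l \<Rightarrow> 'l"
    and scaleS :: "'k \<Rightarrow> 's::comm_ring_1 \<Rightarrow> 's"
    and \<iota> :: "'l \<Rightarrow> 's"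
    and n :: nat
    and l :: "nat \<Rightarrow> 'l"
  assumes "free_prelie_algebra scale pl"
    and "symmetric_algebra scale scaleS \<iota>"
    and "n \<ge> 1"
  shows "prelie_symmetric.sol scale pl scaleS \<iota> 1 (\<Prod>k=1..n. \<iota> (l k)) =
      (\<Sum>i=1..n. scaleS ((-1) ^ (i - 1) / of_nat i)
        (\<Sum>Is \<in> ordered_partitions {1..n} i.
           prelie_symmetric.star_list scale pl scaleS \<iota> (map (\<lambda>I. \<Prod>k\<in>I. \<iota> (l k)) Is)))
    \<and> (\<forall>i. 1 \<le> i \<and> i \<le> n \<longrightarrow>
        prelie_symmetric.sol scale pl scaleS \<iota> i (\<Prod>k=1..n. \<iota> (l k)) =
        (\<Sum>j=i..n. scaleS (of_int (signed_stirling1 j i) / fact j)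
          (\<Sum>Is \<in> ordered_partitions {1..n} j.
             prelie_symmetric.star_list scale pl scaleS \<iota> (map (\<lambda>I. \<Prod>k\<in>I. \<iota> (l k)) Is))))"
proof -
  interpret prelie_symmetric scale pl scaleS \<iota>
    using assms by (simp add: prelie_symmetric_def free_prelie_algebra_def)
  \<comment> \<open>Up to sign the Stirling number is \<open>fact (j - 1)\<close>, and division by
    \<open>fact j\<close> leaves \<open>1 / j\<close>.\<close>
  have coeff: "of_int (signed_stirling1 j 1) / fact j = ((- 1) ^ (j - 1) / of_nat j :: 'k)" if "1 \<le> j" for j
  proof -
    from that obtain m where "j = Suc m" by (cases j) auto
    then show ?thesis using signed_stirling1_Suc_1[of m] by (simp del: of_nat_Suc)
  qed
  have "sol 1 (\<Prod>k=1..n. \<iota> (l k)) = (\<Sum>i=1..n. scaleS ((-1) ^ (i - 1) / of_nat i)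
      (\<Sum>Is\<in>ordered_partitions {1..n} i. star_list (map (\<lambda>I. \<Prod>k\<in>I. \<iota> (l k)) Is)))"
    unfolding sol_prod by (intro sum.cong refl) (simp only: coeff atLeastAtMost_iff)
  then show ?thesis using sol_prod by blast
qed

end
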